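(* Let $X>0$ be a random variable with moments of Gamma type, with associated meromorphic function $F$, let $Y=\log X$, and let $\gamma$, $\rho_+$, $\nu_F$, $c_\ell(\cdot)$ be as in the context. Suppose that $\rho_+<\infty$ and $\gamma>0$. (i) As $x\to\infty$, for some $\eta>0$, $$f_X(x)=x^{-\rho_+-1}\sum_{\ell=0}^{\nu_F(\rho_+)-1}\frac{(-1)^{\ell+1}c_{\ell+1}(\rho_+)}{\ell!}\log^\ell x+O\bigl(x^{-\rho_+-1-\eta}\bigr).$$ In particular, with $\nu:=\nu_F(\rho_+)\ge1$, $$f_X(x)\sim\frac{(-1)^\nu c_\nu(\rho_+)}{(\nu-1)!}\,x^{-\rho_+-1}\log^{\nu-1}x.$$ If $\rho_+$ is a simple pole of $F$, i.e. $\nu=1$, this can be written $f_X(x)\sim-\operatorname{Res}_{\rho_+}(F)\,x^{-\rho_+-1}$. (ii) More precisely, there is an asymptotic expansion: for any fixed $\sigma>0$, as $x\to\infty$, $$f_X(x)=\sum_{0<\rho\le\sigma}\ \sum_{\ell=0}^{\nu_F(\rho)-1}\frac{(-1)^{\ell+1}c_{\ell+1}(\rho)}{\ell!}\,x^{-\rho-1}\log^\ell x+O\bigl(x^{-\sigma-1}\bigr),$$ summing over all poles $\rho$ of $F$ in $(0,\sigma]$. Corresponding asymptotics, as $y\to\infty$, for $f_Y(y)=e^yf_X(e^y)$ are obtained by replacing each $x^{-r-1}$ by $e^{-ry}$ and $\log^\ell x$ by $y^\ell$.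
   Context: A positive random variable $X$ has moments of Gamma type if there exist integers $J,K\ge0$ and real constants $C$, $D>0$, $a_j\ne0$, $b_j$ ($1\le j\le J$), $a'_k\neq0$, $b'_k$ ($1\le k\le K$) such that $$\mathbb E\,X^s=F(s):=C D^s\,\frac{\prod_{j=1}^J\Gamma(a_js+b_j)}{\prod_{k=1}^K\Gamma(a'_ks+b'_k)}$$ for all real $s$ in some interval of positive length. $F$ is regarded as a meromorphic function on $\mathbb C$ (removable singularities removed); all its poles are real. Let $\gamma=\sum_{j}|a_j|-\sum_{k}|a'_k|$ and $\rho_+:=\min\{x>0:x\text{ is a pole of }F\}$, with $\rho_+=\infty$ if there is no such pole. For a pole $s_0$ of $F$, $\nu_F(s_0)\ge1$ denotes its order, and $c_\ell(s_0)$ are the coefficients of the singular part of the Laurent expansion: $F(s)=\sum_{\ell=1}^{\nu_F(s_0)}c_\ell(s_0)(s-s_0)^{-\ell}+O(1)$ as $s\to s_0$; in particular $c_1(s_0)=\operatorname{Res}_{s_0}(F)$. When $\gamma>0$, $X$ and $Y$ are absolutely continuous with densities continuous on $(0,\infty)$ and $\mathbb R$, respectively; $f_X$ and $f_Y$ denote these. *)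

theory Defs
  imports
    "HOL-Probability.Probability"
    "HOL-Complex_Analysis.Complex_Analysis"
    "HOL-Library.Landau_Symbols"
begin

text \<open>
  In the library, \<^term>\<open>Gamma\<close> takes the value 0 at its poles and \<^term>\<open>x / 0 = (0 :: complex)\<close>,
  so the raw quotient of Gamma functions has wrong values on a discrete set;
  \<^const>\<open>remove_sings\<close> replaces them by the limit at each removable singularity
  (and by 0 at each pole).
\<close>

definition gamma_type_fun ::
  "real \<Rightarrow> real \<Rightarrow> nat \<Rightarrow> (nat \<Rightarrow> real) \<Rightarrow> (nat \<Rightarrow> real) \<Rightarrow> nat \<Rightarrow> (nat \<Rightarrow> real) \<Rightarrow> (nat \<Rightarrow> real)
    \<Rightarrow> complex \<Rightarrow> complex" where
  "gamma_type_fun C D J a b K a' b' =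
     remove_sings (\<lambda>s. of_real C * of_real D powr s *
       ((\<Prod>j=1..J. Gamma (of_real (a j) * s + of_real (b j))) /
        (\<Prod>k=1..K. Gamma (of_real (a' k) * s + of_real (b' k)))))"

text \<open>
  Every interval of positive length contains an open one, so quantifying over open intervals
  loses nothing.  Since \<^const>\<open>gamma_type_fun\<close> is 0 at its poles and moments of a positive
  variable are not, no point of the interval is a pole.
\<close>

definition moments_of_gamma_type ::
  "'a measure \<Rightarrow> ('a \<Rightarrow> real) \<Rightarrow> real \<Rightarrow> real \<Rightarrow> nat \<Rightarrow> (nat \<Rightarrow> real) \<Rightarrow> (nat \<Rightarrow> real)
    \<Rightarrow> nat \<Rightarrow> (nat \<Rightarrow> real) \<Rightarrow> (nat \<Rightarrow> real) \<Rightarrow> bool" where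
  "moments_of_gamma_type M X C D J a b K a' b' \<longleftrightarrow>
     D > 0 \<and> (\<forall>j\<in>{1..J}. a j \<noteq> 0) \<and> (\<forall>k\<in>{1..K}. a' k \<noteq> 0) \<and>
     (\<exists>s1 s2. s1 < s2 \<and>
        (\<forall>s\<in>{s1<..<s2}.
           integrable M (\<lambda>\<omega>. X \<omega> powr s) \<and>
           complex_of_real (\<integral>\<omega>. X \<omega> powr s \<partial>M) =
             gamma_type_fun C D J a b K a' b' (of_real s)))"

definition gamma_index :: "nat \<Rightarrow> (nat \<Rightarrow> real) \<Rightarrow> nat \<Rightarrow> (nat \<Rightarrow> real) \<Rightarrow> real" where
  "gamma_index J a K a' = (\<Sum>j=1..J. \<bar>a j\<bar>) - (\<Sum>k=1..K. \<bar>a' k\<bar>)"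

definition rho_plus :: "(complex \<Rightarrow> complex) \<Rightarrow> ereal" where
  "rho_plus F =
     (if \<exists>x::real. 0 < x \<and> is_pole F (of_real x)
      then ereal (LEAST x::real. 0 < x \<and> is_pole F (of_real x))
      else \<infinity>)"

text \<open>\<^const>\<open>zorder\<close> is negative at poles.\<close>

definition pole_order :: "(complex \<Rightarrow> complex) \<Rightarrow> complex \<Rightarrow> nat" where
  "pole_order F z = nat (- zorder F z)"

definition sing_coeff :: "(complex \<Rightarrow> complex) \<Rightarrow> nat \<Rightarrow> complex \<Rightarrow> complex" where
  "sing_coeff F l z = fls_nth (laurent_expansion F z) (- int l)"

text \<open>
  Nonnegativity is required explicitly because \<^const>\<open>ennreal\<close> truncates negative values to 0.
\<close>

definition continuous_density ::
  "'a measure \<Rightarrow> ('a \<Rightarrow> real) \<Rightarrow> real set \<Rightarrow> (real \<Rightarrow> real) \<Rightarrow> bool" where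
  "continuous_density M X S f \<longleftrightarrow>
     distributed M lborel X (\<lambda>x. ennreal (f x)) \<and> (\<forall>x. 0 \<le> f x) \<and> continuous_on S f"

end

theory Submission
  imports Defs "HOL-Real_Asymp.Real_Asymp"
begin

text \<open>
  Stirling-type bounds show that \<open>F\<close> decays like \<open>exp (- (pi / 2) * \<gamma> * \<bar>t\<bar>)\<close>, up to a subexponential
  factor, in vertical strips. They follow without Stirling's formula: for fixed \<open>y\<close> the quotient
  \<open>\<bar>\<Gamma>(x + \<i>y)\<bar> / \<Gamma>(x)\<close> increases with \<open>x > 0\<close>, its value at \<open>x = 1/2\<close> is given by the reflection
  formula, and shifts by integers only cost powers of \<open>\<bar>y\<bar>\<close>.

  On the other hand \<open>F\<close> is the two-sided Laplace transform of the density \<open>f\<close> of \<open>Y = log X\<close> on a strip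
  whose closure contains the origin, so \<open>F\<close> has no pole between the origin and a point \<open>c\<close> of the given
  interval. Fourier inversion writes \<open>f(y)\<close> as the integral of \<open>F(s) exp (- s y) / (2 pi \<i>)\<close> over the
  line \<open>Re s = c\<close>. Moving this line to \<open>Re s = \<sigma>\<close> leaves an error \<open>O(exp (- \<sigma> y))\<close> and picks up the
  residues at the poles in between, which are the terms of the expansion. The statements for \<open>X\<close> follow
  by substituting \<open>y = log x\<close>.
\<close>

section \<open>Growth on vertical lines\<close>

text \<open>Three obstacles shape the argument. The interval on which the moments are given may lie
  away from the origin, while the expansion counts poles from 0 on. Since the density has finite
  mass, the weight at s = 0 is always admissible, and convexity of the exponential fills the gap
  between 0 and the interval; this is what rules out poles between 0 and c. Second, the Gamma
  quotient carries default values on the real axis. Its growth is therefore read off only at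
  non-real points, where the quotient is analytic, and on the given interval the positivity of the
  moments excludes the default value 0 that F takes at a pole. Third, the target line Re s =
  \<sigma> may pass through a pole, or lie to the left of c. The shift then goes farther, to a
  pole-free line to the right of both, and the surplus residues are absorbed by the error term.
  Knowing the exponential rate only up to \<epsilon> suffices: \<gamma> > 0 makes the rate strictly
  negative, which leaves room for every polynomial factor.\<close>

lemma power_le_exp_bound:
  fixes c \<epsilon> :: real
  assumes "\<epsilon> > 0"
  obtains A where "A \<ge> 0" "\<And>t. t \<ge> 0 \<Longrightarrow> (c + t) ^ n \<le> A * exp (\<epsilon> * t)"
proof (cases "n = 0")
  case True
  show ?thesis by (rule that[of 1]) (use True assms in auto)
next
  case False
  \<comment> \<open>The inequality u \<le> exp u is used at u = (d + t) / r; its n-th power produces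
    exp (n (d + t) / r), and this \<open>r\<close> turns the rate n / r into exactly
    \<epsilon>.\<close>
  define r where "r = real n / \<epsilon>"
  have r: "r > 0" using False assms by (simp add: r_def)
  define d where "d = \<bar>c\<bar>"
  have main: "(c + t) ^ n \<le> (r ^ n * exp (\<epsilon> * d)) * exp (\<epsilon> * t)" if "t \<ge> 0" for t
  proof -
    have "\<bar>c + t\<bar> \<le> d + t" using that by (simp add: d_def)
    then have "(c + t) ^ n \<le> (d + t) ^ n"
      using power_mono[of "\<bar>c + t\<bar>" "d + t" n] by (simp add: power_abs [symmetric])
    also have "\<dots> \<le> (r * exp ((d + t) / r)) ^ n"
    proof (rule power_mono)
      have "(d + t) / r \<le> exp ((d + t) / r)"
        using exp_ge_add_one_self[of "(d + t) / r"] by linarith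
      then show "d + t \<le> r * exp ((d + t) / r)" using r by (simp add: field_simps)
    qed (use that in \<open>auto simp: d_def\<close>)
    also have "\<dots> = r ^ n * exp (real n * ((d + t) / r))"
      by (simp only: power_mult_distrib exp_of_nat_mult)
    also have "real n * ((d + t) / r) = \<epsilon> * d + \<epsilon> * t"
      using False assms by (simp add: r_def field_simps)
    finally show ?thesis by (simp add: exp_add mult_ac)
  qed
  show ?thesis by (rule that[OF _ main]) (use r in auto)
qed

text \<open>The exponential rate in \<open>\<bar>Im s\<bar>\<close> is only recorded up to \<open>\<epsilon>\<close>, which absorbs all polynomial factors.\<close>

definition vertical_rate :: "(complex \<Rightarrow> complex) \<Rightarrow> real \<Rightarrow> bool" where
  "vertical_rate f e \<longleftrightarrow> (\<forall>u v \<epsilon>. \<epsilon> > 0 \<longrightarrow> (\<exists>A\<ge>0. \<exists>T. \<forall>x t. u \<le> x \<longrightarrow> x \<le> v \<longrightarrow> T \<le> \<bar>t\<bar> \<longrightarrow>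
     norm (f (Complex x t)) \<le> A * exp ((e + \<epsilon>) * \<bar>t\<bar>)))"

lemma vertical_rateI:
  assumes "\<And>u v \<epsilon>. \<epsilon> > 0 \<Longrightarrow> u \<le> v \<Longrightarrow> \<exists>A\<ge>0. \<exists>T. \<forall>x t. u \<le> x \<longrightarrow> x \<le> v \<longrightarrow> T \<le> \<bar>t\<bar> \<longrightarrow>
     norm (f (Complex x t)) \<le> A * exp ((e + \<epsilon>) * \<bar>t\<bar>)"
  shows "vertical_rate f e"
  unfolding vertical_rate_def
proof (intro allI impI)
  fix u v \<epsilon> :: real assume "\<epsilon> > 0"
  show "\<exists>A\<ge>0. \<exists>T. \<forall>x t. u \<le> x \<longrightarrow> x \<le> v \<longrightarrow> T \<le> \<bar>t\<bar> \<longrightarrow>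
     norm (f (Complex x t)) \<le> A * exp ((e + \<epsilon>) * \<bar>t\<bar>)"
  proof (cases "u \<le> v")
    case True
    then show ?thesis using assms[OF \<open>\<epsilon> > 0\<close>] by blast
  next
    case False
    then show ?thesis by (intro exI[of _ 0]) auto
  qed
qed

lemma vertical_rateE:
  assumes "vertical_rate f e" "\<epsilon> > 0"
  obtains A T where "A \<ge> 0" "\<And>x t. u \<le> x \<Longrightarrow> x \<le> v \<Longrightarrow> T \<le> \<bar>t\<bar> \<Longrightarrow>
     norm (f (Complex x t)) \<le> A * exp ((e + \<epsilon>) * \<bar>t\<bar>)"
  using assms unfolding vertical_rate_def by meson

section \<open>Size of the reciprocal Gamma function at fixed height\<close>

lemma norm_rGamma_series:
  "norm (rGamma_series (Complex x y) n) =
     (\<Prod>k\<le>n. norm (Complex (x + real k) y)) / (fact n * exp (x * ln (real n)))"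
proof -
  have "norm (pochhammer (Complex x y) (Suc n)) = (\<Prod>k\<le>n. norm (Complex (x + real k) y))"
    unfolding pochhammer_Suc_prod prod_norm [symmetric]
    by (intro prod.cong) (auto simp: atLeast0AtMost complex_eq_iff intro!: arg_cong[where f = norm])
  then show ?thesis
    by (simp add: rGamma_series_def norm_divide norm_mult)
qed

text \<open>In Euler's limit for 1 / \<Gamma> the factorials and the powers of n are the same on
  both sides, so the comparison reduces to the linear factors: |x + k + iy| / (x + k) decreases in
  x. The form without quotients passes to the limit directly.\<close>

lemma norm_rGamma_ratio_antimono:
  assumes "0 < x" "x \<le> x'"
  shows "norm (rGamma (Complex x' y)) * rGamma x \<le> norm (rGamma (Complex x y)) * rGamma x'"
proof (rule LIMSEQ_le)
  show "(\<lambda>n. norm (rGamma_series (Complex x' y) n) * rGamma_series x n) \<longlonglongrightarrow>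
          norm (rGamma (Complex x' y)) * rGamma x"
    by (intro tendsto_intros)
  show "(\<lambda>n. norm (rGamma_series (Complex x y) n) * rGamma_series x' n) \<longlonglongrightarrow>
          norm (rGamma (Complex x y)) * rGamma x'"
    by (intro tendsto_intros)
  have factor: "norm (Complex (x' + real k) y) * (x + real k) \<le> norm (Complex (x + real k) y) * (x' + real k)"
    for k
  proof (rule power2_le_imp_le)
    \<comment> \<open>After squaring, both sides contain the product of the squares of x + k and x'
      + k; only the terms with the square of y remain to be compared.\<close>
    have "(x + real k)\<^sup>2 \<le> (x' + real k)\<^sup>2"
      using assms by (intro power_mono) auto
    then have "y\<^sup>2 * (x + real k)\<^sup>2 \<le> y\<^sup>2 * (x' + real k)\<^sup>2"
      by (intro mult_left_mono) auto
    then show "(norm (Complex (x' + real k) y) * (x + real k))\<^sup>2 \<le> (norm (Complex (x + real k) y) * (x' + real k))\<^sup>2"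
      unfolding power_mult_distrib cmod_power2 by (simp add: distrib_left distrib_right mult.commute)
  qed (use assms in auto)
  have "norm (rGamma_series (Complex x' y) n) * rGamma_series x n
      \<le> norm (rGamma_series (Complex x y) n) * rGamma_series x' n" for n
  proof -
    have real_series: "rGamma_series u n = (\<Prod>k\<le>n. u + real k) / (fact n * exp (u * ln (real n)))" for u :: real
      by (simp add: rGamma_series_def pochhammer_Suc_prod atLeast0AtMost flip: Suc_eq_plus1)
    have "(\<Prod>k\<le>n. norm (Complex (x' + real k) y)) * (\<Prod>k\<le>n. x + real k)
        \<le> (\<Prod>k\<le>n. norm (Complex (x + real k) y)) * (\<Prod>k\<le>n. x' + real k)"
      unfolding prod.distrib [symmetric]
      using assms factor by (intro prod_mono conjI mult_nonneg_nonneg) auto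
    then show ?thesis
      unfolding norm_rGamma_series real_series
      by (simp add: divide_right_mono field_simps)
  qed
  then show "\<exists>N. \<forall>n\<ge>N. norm (rGamma_series (Complex x' y) n) * rGamma_series x n
      \<le> norm (rGamma_series (Complex x y) n) * rGamma_series x' n" by blast
qed

text \<open>On the line Re z = 1/2 the reflected point 1 - z is the conjugate of z, so the
  reflection formula evaluates a squared norm.\<close>

lemma norm_rGamma_half_squared: "(norm (rGamma (Complex (1/2) t)))\<^sup>2 = cosh (pi * t) / pi"
proof -
  let ?z = "Complex (1/2) t"
  have "1 - ?z = cnj ?z" by (simp add: complex_eq_iff)
  then have "of_real ((norm (rGamma ?z))\<^sup>2) = rGamma ?z * rGamma (1 - ?z)"
    by (simp only: complex_norm_square cnj_rGamma)
  also have "\<dots> = inverse (Gamma ?z * Gamma (1 - ?z))"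
    by (simp add: rGamma_inverse_Gamma)
  also have "\<dots> = sin (of_real pi * ?z) / of_real pi"
    by (subst Gamma_reflection_complex) simp
  also have "of_real pi * ?z = of_real (pi / 2) + \<i> * of_real (pi * t)"
    by (simp add: complex_eq_iff)
  also have "sin \<dots> = cos (\<i> * of_real (pi * t))"
    by (simp add: sin_add sin_of_real cos_of_real)
  also have "\<dots> = of_real (cosh (pi * t))"
    by (subst cosh_conv_cos [symmetric]) (simp add: cosh_field_def exp_minus flip: exp_of_real)
  finally have "of_real ((norm (rGamma ?z))\<^sup>2) = complex_of_real (cosh (pi * t) / pi)"
    by simp
  then show ?thesis by (simp only: of_real_eq_iff)
qed

lemma norm_rGamma_half_bounds:
  "exp (pi / 2 * \<bar>t\<bar>) \<le> 3 * norm (rGamma (Complex (1/2) t))"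
  "norm (rGamma (Complex (1/2) t)) \<le> exp (pi / 2 * \<bar>t\<bar>)"
proof -
  have cosh: "cosh (pi * t) = (exp (pi * \<bar>t\<bar>) + exp (- (pi * \<bar>t\<bar>))) / 2"
    by (cases "t \<ge> 0") (auto simp: cosh_def)
  have sq: "(exp (pi / 2 * \<bar>t\<bar>))\<^sup>2 = exp (pi * \<bar>t\<bar>)"
    by (simp add: power2_eq_square flip: exp_add)
  have "exp (- (pi * \<bar>t\<bar>)) \<le> exp (pi * \<bar>t\<bar>)" by simp
  then have hi: "cosh (pi * t) \<le> exp (pi * \<bar>t\<bar>)"
    unfolding cosh by simp
  have lo: "exp (pi * \<bar>t\<bar>) \<le> 2 * cosh (pi * t)"
    unfolding cosh by simp
  have pi: "3 < pi" "pi < 4" using pi_gt3 pi_less_4 by auto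
  show "exp (pi / 2 * \<bar>t\<bar>) \<le> 3 * norm (rGamma (Complex (1/2) t))"
  proof (rule power2_le_imp_le)
    \<comment> \<open>The constant 9, and with it the 3 in the claim, only has to exceed 2 pi; pi <
      4 is enough for that.\<close>
    have "2 * cosh (pi * t) \<le> 9 * (cosh (pi * t) / pi)"
      using pi by (simp add: field_simps)
    then show "(exp (pi / 2 * \<bar>t\<bar>))\<^sup>2 \<le> (3 * norm (rGamma (Complex (1/2) t)))\<^sup>2"
      unfolding sq power_mult_distrib norm_rGamma_half_squared using lo by simp
  qed simp
  show "norm (rGamma (Complex (1/2) t)) \<le> exp (pi / 2 * \<bar>t\<bar>)"
  proof (rule power2_le_imp_le)
    have "cosh (pi * t) / pi \<le> cosh (pi * t)"
      using pi by (simp add: field_simps)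
    then show "(norm (rGamma (Complex (1/2) t)))\<^sup>2 \<le> (exp (pi / 2 * \<bar>t\<bar>))\<^sup>2"
      unfolding sq norm_rGamma_half_squared using hi by simp
  qed simp
qed

lemma norm_pochhammer_le:
  fixes z :: complex
  shows "norm (pochhammer z n) \<le> (norm z + real n) ^ n"
proof -
  have "norm (pochhammer z n) = (\<Prod>i<n. norm (z + of_nat i))"
    by (simp add: pochhammer_prod prod_norm atLeast0LessThan)
  also have "\<dots> \<le> (\<Prod>i<n. norm z + real n)"
    by (intro prod_mono conjI norm_ge_zero order.trans[OF norm_triangle_ineq] add_mono) auto
  finally show ?thesis by simp
qed

lemma norm_pochhammer_ge_1:
  assumes "1 \<le> \<bar>t\<bar>"
  shows "1 \<le> norm (pochhammer (Complex x t) n)"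
proof -
  have "1 \<le> norm (Complex x t + of_nat i)" for i
    using assms abs_Im_le_cmod[of "Complex x t + of_nat i"] by simp
  then have "1 \<le> (\<Prod>i<n. norm (Complex x t + of_nat i))"
    by (intro prod_ge_1)
  then show ?thesis
    by (simp add: pochhammer_prod prod_norm atLeast0LessThan)
qed

text \<open>Compactness makes the comparison with the real axis uniform over a strip; the lower
  bound is positive because the interval stays to the right of 0.\<close>

lemma rGamma_real_bounds:
  fixes u v :: real
  assumes "0 < u" "u \<le> v"
  obtains m B where "0 < m" "0 < B" "\<And>x. u \<le> x \<Longrightarrow> x \<le> v \<Longrightarrow> m \<le> rGamma x \<and> rGamma x \<le> B"
proof -
  have pos: "rGamma x > 0" if "x > 0" for x :: real
    using that by (simp add: rGamma_inverse_Gamma)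
  have cont: "continuous_on {u..v} (rGamma :: real \<Rightarrow> real)"
    by (intro continuous_at_imp_continuous_on ballI continuous_intros)
  obtain p where p: "p \<in> {u..v}" "\<And>x. x \<in> {u..v} \<Longrightarrow> rGamma p \<le> rGamma x"
    using continuous_attains_inf[OF _ _ cont] assms by auto
  obtain q where q: "q \<in> {u..v}" "\<And>x. x \<in> {u..v} \<Longrightarrow> rGamma x \<le> rGamma q"
    using continuous_attains_sup[OF _ _ cont] assms by auto
  show ?thesis
    by (rule that[of "rGamma p" "rGamma q"]) (use p q assms pos in auto)
qed


text \<open>An upper bound needs a reference point to the left: the strip is moved to Re \<ge> 1/2
  and compared with the line Re = 1/2. Undoing the move costs a Pochhammer factor, polynomial in the
  height.\<close>

lemma vertical_rate_rGamma: "vertical_rate rGamma (pi / 2)"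
proof (rule vertical_rateI)
  fix u v \<epsilon> :: real assume \<epsilon>: "\<epsilon> > 0" and uv: "u \<le> v"
  \<comment> \<open>This shift gives x + n \<ge> 1/2 for every x in the strip, so that 1/2 can serve
    as the smaller abscissa.\<close>
  obtain n :: nat where n: "1/2 - u \<le> real n" using real_arch_simple by blast
  obtain m B where B: "0 < m" "0 < B"
      "\<And>x. u + n \<le> x \<Longrightarrow> x \<le> v + n \<Longrightarrow> m \<le> rGamma x \<and> rGamma x \<le> B"
    using rGamma_real_bounds[of "u + n" "v + n"] n uv by auto
  have half: "rGamma (1/2 :: real) > 0" by (simp add: rGamma_inverse_Gamma)
  obtain A where A: "A \<ge> 0" "\<And>t. t \<ge> 0 \<Longrightarrow> (\<bar>u\<bar> + \<bar>v\<bar> + n + t) ^ n \<le> A * exp (\<epsilon> * t)"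
    using power_le_exp_bound[OF \<epsilon>] by metis
  define A' where "A' = A * (B / rGamma (1/2))"
  have "norm (rGamma (Complex x t)) \<le> A' * exp ((pi / 2 + \<epsilon>) * \<bar>t\<bar>)"
    if x: "u \<le> x" "x \<le> v" for x t
  proof -
    have shift: "Complex x t + of_nat n = Complex (x + n) t" by (simp add: complex_eq_iff)
    have "norm (rGamma (Complex x t)) = norm (pochhammer (Complex x t) n) * norm (rGamma (Complex (x + n) t))"
      by (subst pochhammer_rGamma[of _ n]) (simp add: norm_mult shift)
    also have "\<dots> \<le> (A * exp (\<epsilon> * \<bar>t\<bar>)) * (exp (pi / 2 * \<bar>t\<bar>) * (B / rGamma (1/2)))"
    proof (rule mult_mono)
      have "norm (pochhammer (Complex x t) n) \<le> (norm (Complex x t) + n) ^ n"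
        by (rule norm_pochhammer_le)
      also have "\<dots> \<le> (\<bar>u\<bar> + \<bar>v\<bar> + n + \<bar>t\<bar>) ^ n"
        using x cmod_le[of "Complex x t"] by (intro power_mono) auto
      also have "\<dots> \<le> A * exp (\<epsilon> * \<bar>t\<bar>)" by (rule A) simp
      finally show "norm (pochhammer (Complex x t) n) \<le> A * exp (\<epsilon> * \<bar>t\<bar>)" .
      have "norm (rGamma (Complex (x + n) t)) * rGamma (1/2) \<le> norm (rGamma (Complex (1/2) t)) * rGamma (x + n)"
        using x n by (intro norm_rGamma_ratio_antimono) auto
      also have "\<dots> \<le> exp (pi / 2 * \<bar>t\<bar>) * B"
        using x B(3)[of "x + n"] B(1) by (intro mult_mono norm_rGamma_half_bounds) auto
      finally show "norm (rGamma (Complex (x + n) t)) \<le> exp (pi / 2 * \<bar>t\<bar>) * (B / rGamma (1/2))"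
        using half by (simp add: field_simps)
    qed (use A in auto)
    finally show ?thesis unfolding A'_def distrib_right exp_add by (simp only: mult_ac)
  qed
  moreover have "A' \<ge> 0" using A B half by (simp add: A'_def)
  ultimately show "\<exists>A\<ge>0. \<exists>T. \<forall>x t. u \<le> x \<longrightarrow> x \<le> v \<longrightarrow> T \<le> \<bar>t\<bar> \<longrightarrow>
     norm (rGamma (Complex x t)) \<le> A * exp ((pi / 2 + \<epsilon>) * \<bar>t\<bar>)" by blast
qed

text \<open>Here the reciprocal must be bounded from below, so the reference point lies to the right
  of the shifted strip, at 1/2 + k; a Pochhammer factor then links it to the line Re = 1/2, where
  the norm is known. The condition 1 \<le> |t| keeps away from the poles.\<close>

lemma vertical_rate_Gamma: "vertical_rate Gamma (- pi / 2)"
proof (rule vertical_rateI)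
  fix u v \<epsilon> :: real assume \<epsilon>: "\<epsilon> > 0" and uv: "u \<le> v"
  obtain n :: nat where n: "1/2 - u \<le> real n" using real_arch_simple by blast
  \<comment> \<open>The two shifts differ in purpose: n makes the strip lie in the right half-plane,
    and k places 1/2 + k beyond its right end v + n.\<close>
  obtain k :: nat where k: "v + n - 1/2 \<le> real k" using real_arch_simple by blast
  obtain m B where B: "0 < m" "0 < B"
      "\<And>x. u + n \<le> x \<Longrightarrow> x \<le> v + n \<Longrightarrow> m \<le> rGamma x \<and> rGamma x \<le> B"
    using rGamma_real_bounds[of "u + n" "v + n"] n uv by auto
  define h where "h = rGamma (1/2 + real k)"
  have h: "h > 0" by (simp add: h_def rGamma_inverse_Gamma)
  obtain A where A: "A \<ge> 0" "\<And>t. t \<ge> 0 \<Longrightarrow> (1/2 + k + t) ^ k \<le> A * exp (\<epsilon> * t)"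
    using power_le_exp_bound[OF \<epsilon>] by metis
  define A' where "A' = 3 * A * h / m"
  have "norm (Gamma (Complex x t)) \<le> A' * exp ((- pi / 2 + \<epsilon>) * \<bar>t\<bar>)"
    if x: "u \<le> x" "x \<le> v" and t: "1 \<le> \<bar>t\<bar>" for x t
  proof -
    let ?G = "norm (rGamma (Complex x t))"
    have shift: "Complex x t + of_nat n = Complex (x + n) t" "Complex (1/2) t + of_nat k = Complex (1/2 + k) t"
      by (simp_all add: complex_eq_iff)
    have nonzero: "?G > 0"
    proof -
      have "Complex x t \<notin> \<real>" using t by (auto simp: complex_is_Real_iff)
      then show ?thesis
        by (auto simp: rGamma_eq_zero_iff elim!: nonpos_Ints_cases)
    qed
    have "exp (pi / 2 * \<bar>t\<bar>) \<le> 3 * norm (rGamma (Complex (1/2) t))"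
      by (rule norm_rGamma_half_bounds)
    also have "\<dots> = 3 * (norm (pochhammer (Complex (1/2) t) k) * norm (rGamma (Complex (1/2 + k) t)))"
      by (subst pochhammer_rGamma[of _ k]) (simp add: norm_mult shift)
    also have "\<dots> \<le> 3 * ((A * exp (\<epsilon> * \<bar>t\<bar>)) * (?G * (h / m)))"
    proof (intro mult_left_mono mult_mono)
      have "norm (pochhammer (Complex (1/2) t) k) \<le> (norm (Complex (1/2) t) + k) ^ k"
        by (rule norm_pochhammer_le)
      also have "\<dots> \<le> (1/2 + k + \<bar>t\<bar>) ^ k"
        using cmod_le[of "Complex (1/2) t"] by (intro power_mono) auto
      also have "\<dots> \<le> A * exp (\<epsilon> * \<bar>t\<bar>)" by (rule A) simp
      finally show "norm (pochhammer (Complex (1/2) t) k) \<le> A * exp (\<epsilon> * \<bar>t\<bar>)" .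
      have "norm (rGamma (Complex (1/2 + k) t)) * m \<le> norm (rGamma (Complex (1/2 + k) t)) * rGamma (x + n)"
        using x B(3)[of "x + n"] by (intro mult_left_mono) auto
      also have "\<dots> \<le> norm (rGamma (Complex (x + n) t)) * h"
        unfolding h_def using x n k by (intro norm_rGamma_ratio_antimono) auto
      \<comment> \<open>For 1 \<le> |t| every factor of the Pochhammer symbol has norm at least 1,
        so going back from x + n to x loses nothing.\<close>
      also have "\<dots> \<le> (norm (pochhammer (Complex x t) n) * norm (rGamma (Complex (x + n) t))) * h"
        using norm_pochhammer_ge_1[OF t] h by (intro mult_right_mono) (auto simp: mult_le_cancel_right1)
      also have "\<dots> = ?G * h"
        by (subst (2) pochhammer_rGamma[of _ n]) (simp add: norm_mult shift)
      finally show "norm (rGamma (Complex (1/2 + k) t)) \<le> ?G * (h / m)"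
        using B by (simp add: field_simps)
    qed (use A in auto)
    finally have "exp (pi / 2 * \<bar>t\<bar>) \<le> ?G * (A' * exp (\<epsilon> * \<bar>t\<bar>))"
      by (simp add: A'_def mult_ac)
    then have "exp (- (pi / 2 * \<bar>t\<bar>)) * exp (pi / 2 * \<bar>t\<bar>) \<le> exp (- (pi / 2 * \<bar>t\<bar>)) * (?G * (A' * exp (\<epsilon> * \<bar>t\<bar>)))"
      by (intro mult_left_mono) auto
    then have "1 / ?G \<le> A' * (exp (- (pi / 2 * \<bar>t\<bar>)) * exp (\<epsilon> * \<bar>t\<bar>))"
      using nonzero by (simp add: field_simps flip: exp_add)
    also have "exp (- (pi / 2 * \<bar>t\<bar>)) * exp (\<epsilon> * \<bar>t\<bar>) = exp ((- pi / 2 + \<epsilon>) * \<bar>t\<bar>)"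
      by (simp add: algebra_simps flip: exp_add)
    finally show ?thesis by (simp add: Gamma_def norm_divide inverse_eq_divide)
  qed
  moreover have "A' \<ge> 0" using A B h by (simp add: A'_def)
  ultimately show "\<exists>A\<ge>0. \<exists>T. \<forall>x t. u \<le> x \<longrightarrow> x \<le> v \<longrightarrow> T \<le> \<bar>t\<bar> \<longrightarrow>
     norm (Gamma (Complex x t)) \<le> A * exp ((- pi / 2 + \<epsilon>) * \<bar>t\<bar>)" by blast
qed

section \<open>Exponential rates under products and affine substitution\<close>

lemma vertical_rate_mult:
  assumes "vertical_rate f e" "vertical_rate g e'"
  shows "vertical_rate (\<lambda>s. f s * g s) (e + e')"
proof (rule vertical_rateI)
  fix u v \<epsilon> :: real assume \<epsilon>: "\<epsilon> > 0"
  obtain A T where A: "A \<ge> 0" "\<And>x t. u \<le> x \<Longrightarrow> x \<le> v \<Longrightarrow> T \<le> \<bar>t\<bar> \<Longrightarrow>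
      norm (f (Complex x t)) \<le> A * exp ((e + \<epsilon> / 2) * \<bar>t\<bar>)"
    using vertical_rateE[OF assms(1), of "\<epsilon> / 2" u v] \<epsilon> by (metis half_gt_zero)
  obtain B S where B: "B \<ge> 0" "\<And>x t. u \<le> x \<Longrightarrow> x \<le> v \<Longrightarrow> S \<le> \<bar>t\<bar> \<Longrightarrow>
      norm (g (Complex x t)) \<le> B * exp ((e' + \<epsilon> / 2) * \<bar>t\<bar>)"
    using vertical_rateE[OF assms(2), of "\<epsilon> / 2" u v] \<epsilon> by (metis half_gt_zero)
  have "norm (f (Complex x t) * g (Complex x t)) \<le> (A * B) * exp ((e + e' + \<epsilon>) * \<bar>t\<bar>)"
    if "u \<le> x" "x \<le> v" "max T S \<le> \<bar>t\<bar>" for x t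
  proof -
    have "norm (f (Complex x t) * g (Complex x t))
        \<le> (A * exp ((e + \<epsilon> / 2) * \<bar>t\<bar>)) * (B * exp ((e' + \<epsilon> / 2) * \<bar>t\<bar>))"
      unfolding norm_mult using that A B by (intro mult_mono) auto
    also have "\<dots> = (A * B) * exp ((e + \<epsilon> / 2) * \<bar>t\<bar> + (e' + \<epsilon> / 2) * \<bar>t\<bar>)"
      by (simp add: exp_add)
    also have "(e + \<epsilon> / 2) * \<bar>t\<bar> + (e' + \<epsilon> / 2) * \<bar>t\<bar> = (e + e' + \<epsilon>) * \<bar>t\<bar>"
      by (simp add: field_simps)
    finally show ?thesis .
  qed
  then show "\<exists>A\<ge>0. \<exists>T. \<forall>x t. u \<le> x \<longrightarrow> x \<le> v \<longrightarrow> T \<le> \<bar>t\<bar> \<longrightarrow>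
     norm (f (Complex x t) * g (Complex x t)) \<le> A * exp ((e + e' + \<epsilon>) * \<bar>t\<bar>)"
    using A(1) B(1) by (intro exI[of _ "A * B"] conjI exI[of _ "max T S"]) auto
qed

lemma vertical_rate_const: "vertical_rate (\<lambda>_. c) 0"
proof (rule vertical_rateI)
  fix u v \<epsilon> :: real assume "\<epsilon> > 0"
  then have "norm c \<le> norm c * exp ((0 + \<epsilon>) * \<bar>t\<bar>)" for t
    by (simp add: mult_le_cancel_left1)
  then show "\<exists>A\<ge>0. \<exists>T. \<forall>x t. u \<le> x \<longrightarrow> x \<le> v \<longrightarrow> T \<le> \<bar>t\<bar> \<longrightarrow> norm c \<le> A * exp ((0 + \<epsilon>) * \<bar>t\<bar>)"
    using norm_ge_zero by blast
qed

lemma vertical_rate_prod: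
  assumes "\<And>i. i \<in> I \<Longrightarrow> vertical_rate (f i) (e i)"
  shows "vertical_rate (\<lambda>s. \<Prod>i\<in>I. f i s) (\<Sum>i\<in>I. e i)"
  using assms
  by (induction I rule: infinite_finite_induct) (auto intro: vertical_rate_const vertical_rate_mult)

lemma vertical_rate_linear:
  assumes "vertical_rate f e" "a \<noteq> 0"
  shows "vertical_rate (\<lambda>s. f (of_real a * s + of_real b)) (\<bar>a\<bar> * e)"
proof (rule vertical_rateI)
  fix u v \<epsilon> :: real assume \<epsilon>: "\<epsilon> > 0"
  \<comment> \<open>The interval from -R to R contains all real parts a x + b, whatever the sign of
    \<open>a\<close>; the slack \<epsilon> / |a| becomes \<epsilon> because heights are multiplied
    by |a|.\<close>
  define R where "R = \<bar>a\<bar> * (\<bar>u\<bar> + \<bar>v\<bar>) + \<bar>b\<bar>"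
  have "\<epsilon> / \<bar>a\<bar> > 0" using \<epsilon> assms by simp
  then obtain A T where A: "A \<ge> 0" "\<And>x t. - R \<le> x \<Longrightarrow> x \<le> R \<Longrightarrow> T \<le> \<bar>t\<bar> \<Longrightarrow>
      norm (f (Complex x t)) \<le> A * exp ((e + \<epsilon> / \<bar>a\<bar>) * \<bar>t\<bar>)"
    using vertical_rateE[OF assms(1), of "\<epsilon> / \<bar>a\<bar>" "- R" R] by metis
  have "norm (f (of_real a * Complex x t + of_real b)) \<le> A * exp ((\<bar>a\<bar> * e + \<epsilon>) * \<bar>t\<bar>)"
    if "u \<le> x" "x \<le> v" "T / \<bar>a\<bar> \<le> \<bar>t\<bar>" for x t
  proof -
    have "\<bar>a * x\<bar> \<le> \<bar>a\<bar> * (\<bar>u\<bar> + \<bar>v\<bar>)"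
      unfolding abs_mult using that by (intro mult_left_mono) auto
    then have "\<bar>a * x + b\<bar> \<le> R" unfolding R_def by linarith
    moreover have "T \<le> \<bar>a * t\<bar>"
      using that assms(2) by (simp add: field_simps abs_mult)
    ultimately have "norm (f (Complex (a * x + b) (a * t))) \<le> A * exp ((e + \<epsilon> / \<bar>a\<bar>) * \<bar>a * t\<bar>)"
      by (intro A) auto
    also have "(e + \<epsilon> / \<bar>a\<bar>) * \<bar>a * t\<bar> = (\<bar>a\<bar> * e + \<epsilon>) * \<bar>t\<bar>"
      using assms(2) by (simp add: field_simps abs_mult)
    also have "Complex (a * x + b) (a * t) = of_real a * Complex x t + of_real b"
      by (simp add: complex_eq_iff)
    finally show ?thesis .
  qed
  then show "\<exists>A\<ge>0. \<exists>T. \<forall>x t. u \<le> x \<longrightarrow> x \<le> v \<longrightarrow> T \<le> \<bar>t\<bar> \<longrightarrow>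
     norm (f (of_real a * Complex x t + of_real b)) \<le> A * exp ((\<bar>a\<bar> * e + \<epsilon>) * \<bar>t\<bar>)"
    using A(1) by blast
qed

text \<open>The norm of D^s depends only on the real part of s, hence is bounded on a strip.\<close>

lemma vertical_rate_powr:
  assumes "D > 0"
  shows "vertical_rate (\<lambda>s. of_real D powr s) 0"
proof (rule vertical_rateI)
  fix u v \<epsilon> :: real assume "\<epsilon> > 0"
  define A where "A = exp (\<bar>ln D\<bar> * (\<bar>u\<bar> + \<bar>v\<bar>))"
  have "norm (of_real D powr Complex x t) \<le> A * exp ((0 + \<epsilon>) * \<bar>t\<bar>)" if "u \<le> x" "x \<le> v" for x t
  proof -
    have "x * ln D \<le> \<bar>ln D\<bar> * \<bar>x\<bar>" by (metis abs_ge_self abs_mult mult.commute)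
    also have "\<dots> \<le> \<bar>ln D\<bar> * (\<bar>u\<bar> + \<bar>v\<bar>)" using that by (intro mult_left_mono) auto
    finally have "norm (of_real D powr Complex x t) \<le> A"
      using assms by (simp add: powr_def A_def norm_exp Ln_of_real)
    also have "\<dots> \<le> A * exp ((0 + \<epsilon>) * \<bar>t\<bar>)"
      using \<open>\<epsilon> > 0\<close> by (simp add: A_def mult_le_cancel_left1)
    finally show ?thesis .
  qed
  moreover have "A \<ge> 0" by (simp add: A_def)
  ultimately show "\<exists>A\<ge>0. \<exists>T. \<forall>x t. u \<le> x \<longrightarrow> x \<le> v \<longrightarrow> T \<le> \<bar>t\<bar> \<longrightarrow>
      norm (of_real D powr Complex x t) \<le> A * exp ((0 + \<epsilon>) * \<bar>t\<bar>)"
    by blast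
qed

section \<open>Functions of Gamma type\<close>

lemma rGamma_nonreal_neq_0:
  assumes "Im z \<noteq> 0"
  shows "rGamma z \<noteq> 0"
  using assms by (auto simp: rGamma_eq_zero_iff elim!: nonpos_Ints_cases)

locale gamma_type_data =
  fixes C D :: real and J K :: nat and a b a' b' :: "nat \<Rightarrow> real"
  assumes D: "D > 0"
    and a: "\<And>j. j \<in> {1..J} \<Longrightarrow> a j \<noteq> 0" and a': "\<And>k. k \<in> {1..K} \<Longrightarrow> a' k \<noteq> 0"
begin

text \<open>Written with the entire function \<open>rGamma\<close>, so that singularities can come
  only from its zeros in the first product. As \<open>inverse 0 = 0\<close> is also the value of
  \<open>Gamma\<close> at its poles, this agrees everywhere with the raw quotient.\<close>

definition gamma_quotient :: "complex \<Rightarrow> complex" where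
  "gamma_quotient s = of_real C * of_real D powr s *
     ((\<Prod>j=1..J. inverse (rGamma (of_real (a j) * s + of_real (b j)))) *
      (\<Prod>k=1..K. rGamma (of_real (a' k) * s + of_real (b' k))))"

lemma gamma_type_fun_conv: "gamma_type_fun C D J a b K a' b' = remove_sings gamma_quotient"
  unfolding gamma_type_fun_def gamma_quotient_def Gamma_def
  by (simp add: divide_inverse flip: prod_inversef)

lemma gamma_quotient_meromorphic: "gamma_quotient meromorphic_on UNIV"
proof -
  have "(\<lambda>s. of_real D powr s) meromorphic_on UNIV"
    using D by (intro analytic_on_imp_meromorphic_on) (auto simp: analytic_on_open intro!: holomorphic_intros)
  moreover have "(\<lambda>s. rGamma (of_real u * s + of_real v)) meromorphic_on UNIV" for u v
    by (intro analytic_on_imp_meromorphic_on) (auto simp: analytic_on_open intro!: holomorphic_intros)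
  ultimately show ?thesis
    unfolding gamma_quotient_def by (intro meromorphic_intros)
qed

text \<open>The zeros of \<open>rGamma\<close> are real, while each argument has imaginary part a_j
  Im z, which is non-zero.\<close>

lemma gamma_quotient_analytic:
  assumes "Im z \<noteq> 0"
  shows "gamma_quotient analytic_on {z}"
proof -
  let ?U = "{z. 0 < Im z \<or> Im z < 0}"
  have op: "open ?U" by (intro open_Collect_disj open_Collect_less continuous_intros)
  have "gamma_quotient holomorphic_on ?U"
    unfolding gamma_quotient_def using D a
    by (intro holomorphic_intros) (auto intro!: rGamma_nonreal_neq_0)
  then show ?thesis using op assms by (auto simp: analytic_at)
qed

lemma gamma_type_fun_nicely_meromorphic: "gamma_type_fun C D J a b K a' b' nicely_meromorphic_on UNIV"
  unfolding gamma_type_fun_conv using gamma_quotient_meromorphic by (rule remove_sings_nicely_meromorphic)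

lemma gamma_type_fun_nonreal:
  assumes "Im z \<noteq> 0"
  shows "gamma_type_fun C D J a b K a' b' z = gamma_quotient z"
  unfolding gamma_type_fun_conv using gamma_quotient_analytic[OF assms] by simp

lemma gamma_type_fun_poles_real:
  assumes "is_pole (gamma_type_fun C D J a b K a' b') z"
  shows "Im z = 0"
proof (rule ccontr)
  assume "Im z \<noteq> 0"
  then have "gamma_type_fun C D J a b K a' b' analytic_on {z}"
    unfolding gamma_type_fun_conv by (intro remove_sings_analytic_on gamma_quotient_analytic)
  with assms show False by (simp add: analytic_at_imp_no_pole)
qed

text \<open>Each numerator factor contributes the rate -(pi / 2) |a_j| and each denominator factor
  (pi / 2) |a'_k|; the rates add up to the multiple of \<gamma>.\<close>

lemma gamma_type_fun_vertical_rate: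
  "vertical_rate (gamma_type_fun C D J a b K a' b') (- (pi / 2) * gamma_index J a K a')"
proof -
  have "vertical_rate (\<lambda>s. Gamma (of_real (a j) * s + of_real (b j))) (\<bar>a j\<bar> * (- pi / 2))" if "j \<in> {1..J}" for j
    by (rule vertical_rate_linear[OF vertical_rate_Gamma a[OF that]])
  moreover have "vertical_rate (\<lambda>s. rGamma (of_real (a' k) * s + of_real (b' k))) (\<bar>a' k\<bar> * (pi / 2))" if "k \<in> {1..K}" for k
    by (rule vertical_rate_linear[OF vertical_rate_rGamma a'[OF that]])
  ultimately have "vertical_rate (\<lambda>s. of_real C * of_real D powr s *
      ((\<Prod>j=1..J. Gamma (of_real (a j) * s + of_real (b j))) *
       (\<Prod>k=1..K. rGamma (of_real (a' k) * s + of_real (b' k)))))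
      (0 + 0 + ((\<Sum>j=1..J. \<bar>a j\<bar> * (- pi / 2)) + (\<Sum>k=1..K. \<bar>a' k\<bar> * (pi / 2))))"
    using D by (intro vertical_rate_mult vertical_rate_const vertical_rate_powr vertical_rate_prod)
  also have "(0 + 0 + ((\<Sum>j=1..J. \<bar>a j\<bar> * (- pi / 2)) + (\<Sum>k=1..K. \<bar>a' k\<bar> * (pi / 2))))
      = - (pi / 2) * gamma_index J a K a'"
    unfolding gamma_index_def by (simp add: algebra_simps sum_negf flip: sum_distrib_left sum_distrib_right sum_divide_distrib)
  finally have rate: "vertical_rate gamma_quotient (- (pi / 2) * gamma_index J a K a')"
    by (simp add: gamma_quotient_def [abs_def] Gamma_def)
  show ?thesis
  proof (rule vertical_rateI)
    fix u v \<epsilon> :: real assume \<epsilon>: "\<epsilon> > 0"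
    obtain A T where A: "A \<ge> 0" "\<And>x t. u \<le> x \<Longrightarrow> x \<le> v \<Longrightarrow> T \<le> \<bar>t\<bar> \<Longrightarrow>
       norm (gamma_quotient (Complex x t)) \<le> A * exp ((- (pi / 2) * gamma_index J a K a' + \<epsilon>) * \<bar>t\<bar>)"
      using vertical_rateE[OF rate \<epsilon>, of u v] by metis
    then show "\<exists>A\<ge>0. \<exists>T. \<forall>x t. u \<le> x \<longrightarrow> x \<le> v \<longrightarrow> T \<le> \<bar>t\<bar> \<longrightarrow>
       norm (gamma_type_fun C D J a b K a' b' (Complex x t)) \<le> A * exp ((- (pi / 2) * gamma_index J a K a' + \<epsilon>) * \<bar>t\<bar>)"
      \<comment> \<open>Heights of at least 1 are off the real axis, where removing singularities
        changes no value.\<close>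
      by (intro exI[of _ A] conjI exI[of _ "max T 1"]) (auto simp: gamma_type_fun_nonreal)
  qed
qed

end

section \<open>Fourier inversion\<close>

text \<open>By the fundamental theorem of calculus a continuous function is the derivative of its
  integral. This upgrades statements about intervals to pointwise ones, both for Fourier inversion
  and for the comparison of densities.\<close>

lemma continuous_eqI_integral:
  fixes f g :: "real \<Rightarrow> real"
  assumes f: "continuous_on UNIV f" and g: "continuous_on UNIV g"
    and eq: "\<And>a b. a \<le> b \<Longrightarrow> integral {a..b} f = integral {a..b} g"
  shows "f x = g x"
proof -
  have deriv: "((\<lambda>u. integral {x - 1..u} h) has_real_derivative h x) (at x)" if "continuous_on UNIV h" for h
  proof -
    have "((\<lambda>u. integral {x - 1..u} h) has_real_derivative h x) (at x within {x - 1..x + 1})"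
      by (rule integral_has_real_derivative) (auto intro: continuous_on_subset[OF that])
    then show ?thesis by (simp add: at_within_Icc_at)
  qed
  have "((\<lambda>u. integral {x - 1..u} g) has_real_derivative f x) (at x)"
  proof (rule has_field_derivative_transform_within_open[OF deriv[OF f], of "{x - 1<..}"])
    show "integral {x - 1..u} f = integral {x - 1..u} g" if "u \<in> {x - 1<..}" for u
      using that by (intro eq) auto
  qed auto
  then show ?thesis using deriv[OF g] by (rule DERIV_unique)
qed

text \<open>The right-hand side is the kernel of Levy's inversion formula; as an integral over y it
  becomes accessible to Fubini.\<close>

lemma integral_iexp_Icc:
  assumes "a \<le> b" "t \<noteq> 0"
  shows "(\<integral>y. indicator {a..b} y *\<^sub>R iexp (- (t * y)) \<partial>lborel) = (iexp (- (t * a)) - iexp (- (t * b))) / (\<i> * t)"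
proof -
  have "(\<integral>y. indicator {a..b} y *\<^sub>R iexp (- (t * y)) \<partial>lborel)
      = iexp (- (t * b)) / (- (\<i> * t)) - iexp (- (t * a)) / (- (\<i> * t))"
    using assms
    by (intro integral_FTC_Icc continuous_intros)
       (auto intro!: derivative_eq_intros has_vector_derivative_real_field simp: field_simps)
  then show ?thesis using assms by (simp add: field_simps)
qed

text \<open>Uniformity in t makes this the dominating constant for Levy's kernel. At t = 0 division
  by zero gives the value 0, which satisfies the bound too.\<close>

lemma norm_iexp_diff_quotient_le:
  assumes "a \<le> b"
  shows "norm ((iexp (- (t * a)) - iexp (- (t * b))) / (\<i> * of_real t)) \<le> b - a"
proof (cases "t = 0")
  case False
  have "norm (iexp (- (t * a)) - iexp (- (t * b))) = norm (iexp (- t * b) - iexp (- t * a))"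
    by (simp add: norm_minus_commute)
  with Levy_Inversion_aux2[OF assms, of "- t"] False show ?thesis
    by (simp add: norm_divide norm_mult)
qed (use assms in auto)

text \<open>The function \<open>g\<close> is meant to be a probability density tilted by an
  exponential weight, so its mass is only known to be finite and positive.\<close>

locale fourier_pair =
  fixes g :: "real \<Rightarrow> real" and \<phi> :: "real \<Rightarrow> complex"
  assumes nonneg: "\<And>y. 0 \<le> g y" and cont: "continuous_on UNIV g"
    and int_g: "integrable lborel g" and int_pos: "(\<integral>y. g y \<partial>lborel) > 0"
    and \<phi>: "\<And>t. \<phi> t = (\<integral>y. of_real (g y) * iexp (t * y) \<partial>lborel)"
    and int_\<phi>: "integrable lborel \<phi>"
begin

lemma borel_g [measurable]: "g \<in> borel_measurable borel"
  using int_g by (simp add: borel_measurable_integrable)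

lemma borel_\<phi> [measurable]: "\<phi> \<in> borel_measurable borel"
  using int_\<phi> by (simp add: borel_measurable_integrable)

text \<open>Levy's inversion theorem for the normalised measure. Since \<phi> is integrable, the
  limit of truncated integrals is an honest integral.\<close>

lemma fourier_inversion_Ioc:
  assumes "a \<le> b"
  shows "complex_of_real (integral {a..b} g)
     = 1 / (2 * pi) * (\<integral>t. (iexp (- (t * a)) - iexp (- (t * b))) / (\<i> * t) * \<phi> t \<partial>lborel)"
proof -
  define m where "m = (\<integral>y. g y \<partial>lborel)"
  define N where "N = density lborel (\<lambda>y. ennreal (g y / m))"
  have m: "m > 0" using int_pos by (simp add: m_def)
  have emeasure_N: "emeasure N A = ennreal (\<integral>y. indicator A y * (g y / m) \<partial>lborel)" if "A \<in> sets borel" for A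
  proof -
    have "emeasure N A = (\<integral>\<^sup>+y. ennreal (indicator A y * (g y / m)) \<partial>lborel)"
      unfolding N_def using that m nonneg
      by (subst emeasure_density) (auto intro!: nn_integral_cong simp: indicator_def)
    also have "\<dots> = ennreal (\<integral>y. indicator A y * (g y / m) \<partial>lborel)"
    proof (rule nn_integral_eq_integral)
      show "integrable lborel (\<lambda>y. indicator A y * (g y / m))"
        using integrable_real_mult_indicator[of A lborel "\<lambda>y. g y / m"] that int_g
        by (simp add: mult.commute)
    qed (use m nonneg in auto)
    finally show ?thesis .
  qed
  have "emeasure N (space N) = 1"
    using emeasure_N[of UNIV] m by (simp add: N_def m_def)
  then interpret N: prob_space N by (rule prob_spaceI)
  interpret N: real_distribution N
    by unfold_locales (simp add: N_def)
  have measure_N: "measure N A = (\<integral>y. indicator A y * (g y / m) \<partial>lborel)" if "A \<in> sets borel" for A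
    unfolding measure_def emeasure_N[OF that] using m nonneg by (intro enn2real_ennreal integral_nonneg) auto
  have N_Icc: "measure N {a..b} = integral {a..b} g / m"
  proof -
    have "set_integrable lborel {a..b} g"
      by (intro borel_integrable_atLeastAtMost' continuous_on_subset[OF cont]) auto
    from set_borel_integral_eq_integral(2)[OF this]
    show ?thesis by (simp add: measure_N set_lebesgue_integral_def)
  qed
  \<comment> \<open>Levy's theorem asks that the endpoints carry no mass; this also makes closed and
    half-open intervals interchangeable.\<close>
  have point: "measure N {x} = 0" for x
  proof -
    have "emeasure N {x} = (\<integral>\<^sup>+y. ennreal (g y / m) * indicator {x} y \<partial>lborel)"
      unfolding N_def by (rule emeasure_density) auto
    also have "\<dots> = (\<integral>\<^sup>+y. 0 \<partial>(lborel :: real measure))"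
      by (intro nn_integral_cong_AE) (use AE_lborel_singleton[of x] in \<open>auto elim!: eventually_mono\<close>)
    finally show ?thesis by (simp add: measure_def)
  qed
  have "measure N {a..b} = measure N ({a} \<union> {a<..b})"
    using assms by (intro arg_cong[where f = "measure N"]) auto
  also have "\<dots> = measure N {a<..b}"
    by (subst N.finite_measure_Union) (auto simp: point)
  finally have N_Ioc: "measure N {a<..b} = integral {a..b} g / m" using N_Icc by simp
  have char: "char N t = \<phi> t / m" for t
  proof -
    have "char N t = (\<integral>y. (g y / m) *\<^sub>R iexp (t * y) \<partial>lborel)"
      unfolding char_def N_def using m nonneg by (subst integral_density) auto
    also have "\<dots> = (\<integral>y. (of_real (g y) * iexp (t * y)) / of_real m \<partial>lborel)"
      by (intro Bochner_Integration.integral_cong) (auto simp: scaleR_conv_of_real)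
    finally show ?thesis by (simp add: \<phi>)
  qed
  let ?K = "\<lambda>t. (iexp (- (t * a)) - iexp (- (t * b))) / (\<i> * of_real t)"
  have levy: "(\<lambda>T. 1 / (2 * pi) * (CLBINT t=ereal (- real T)..ereal (real T). ?K t * char N t)) \<longlonglongrightarrow> measure N {a<..b}"
    using N.Levy_Inversion[OF assms point point] by (simp only: of_int_minus of_int_of_nat_eq)
  have lim: "(\<lambda>T. CLBINT t=ereal (- real T)..ereal (real T). ?K t * char N t) \<longlonglongrightarrow> (\<integral>t. ?K t * char N t \<partial>lborel)"
  proof -
    have "(CLBINT t=ereal (- real T)..ereal (real T). ?K t * char N t) = (\<integral>t. indicator {-real T<..<real T} t *\<^sub>R (?K t * char N t) \<partial>lborel)" for T
      by (subst interval_lebesgue_integral_le_eq) (auto simp: set_lebesgue_integral_def)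
    moreover have "(\<lambda>T. \<integral>t. indicator {-real T<..<real T} t *\<^sub>R (?K t * char N t) \<partial>lborel)
        \<longlonglongrightarrow> (\<integral>t. ?K t * char N t \<partial>lborel)"
    proof (rule integral_dominated_convergence[where w = "\<lambda>t. (b - a) * (norm (\<phi> t) / m)"])
      show "integrable lborel (\<lambda>t. (b - a) * (norm (\<phi> t) / m))"
        using int_\<phi> by simp
      show "AE t in lborel. (\<lambda>T. indicator {-real T<..<real T} t *\<^sub>R (?K t * char N t)) \<longlonglongrightarrow> ?K t * char N t"
      proof (rule AE_I2)
        fix t :: real
        have "eventually (\<lambda>T. indicator {-real T<..<real T} t *\<^sub>R (?K t * char N t) = ?K t * char N t) sequentially"
          using eventually_gt_at_top[of "nat \<lceil>\<bar>t\<bar>\<rceil>"]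
        proof eventually_elim
          case (elim T)
          then have "\<bar>t\<bar> < real T" by linarith
          then have "t \<in> {-real T<..<real T}" by auto
          then show ?case by simp
        qed
        then show "(\<lambda>T. indicator {-real T<..<real T} t *\<^sub>R (?K t * char N t)) \<longlonglongrightarrow> ?K t * char N t"
          by (rule tendsto_eventually)
      qed
      show "AE t in lborel. norm (indicator {-real T<..<real T} t *\<^sub>R (?K t * char N t)) \<le> (b - a) * (norm (\<phi> t) / m)" for T
      proof (rule AE_I2)
        fix t :: real
        have "norm (?K t * char N t) \<le> (b - a) * (norm (\<phi> t) / m)"
          unfolding norm_mult using m assms
          by (intro mult_mono norm_iexp_diff_quotient_le) (auto simp: char norm_divide)
        then show "norm (indicator {-real T<..<real T} t *\<^sub>R (?K t * char N t)) \<le> (b - a) * (norm (\<phi> t) / m)"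
          using m assms by (auto simp: indicator_def)
      qed
    qed (auto simp: char)
    ultimately show ?thesis by simp
  qed
  have "complex_of_real (measure N {a<..b}) = of_real (1 / (2 * pi)) * (\<integral>t. ?K t * char N t \<partial>lborel)"
    by (rule LIMSEQ_unique[OF levy tendsto_mult_left[OF lim]])
  also have "(\<integral>t. ?K t * char N t \<partial>lborel) = (\<integral>t. (?K t * \<phi> t) / of_real m \<partial>lborel)"
    by (intro Bochner_Integration.integral_cong) (auto simp: char)
  also have "\<dots> = (\<integral>t. ?K t * \<phi> t \<partial>lborel) / of_real m"
    by (rule integral_divide_zero)
  finally show ?thesis unfolding N_Ioc using m by (simp add: field_simps)
qed

lemma integrable_\<phi>_iexp: "integrable lborel (\<lambda>t. \<phi> t * iexp (- (t * y)))"
  by (rule Bochner_Integration.integrable_bound[OF int_\<phi>]) (auto simp: norm_mult)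

definition inverse_transform :: "real \<Rightarrow> complex" where
  "inverse_transform y = (\<integral>t. \<phi> t * iexp (- (t * y)) \<partial>lborel)"

lemma continuous_inverse_transform: "continuous_on UNIV inverse_transform"
proof (rule continuous_at_imp_continuous_on, rule ballI)
  fix y
  have "(inverse_transform \<circ> X) \<longlonglongrightarrow> inverse_transform y" if "X \<longlonglongrightarrow> y" for X :: "nat \<Rightarrow> real"
    unfolding inverse_transform_def o_def
  proof (rule integral_dominated_convergence[where w = "\<lambda>t. norm (\<phi> t)"])
    show "AE t in lborel. (\<lambda>n. \<phi> t * iexp (- (t * X n))) \<longlonglongrightarrow> \<phi> t * iexp (- (t * y))"
      by (intro AE_I2 tendsto_intros that)
  qed (use int_\<phi> in \<open>auto simp: norm_mult\<close>)
  then show "isCont inverse_transform y"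
    unfolding continuous_at_sequentially by auto
qed

text \<open>Writing Levy's kernel as an integral over the interval and exchanging the order shows
  that both sides have the same integral over every interval; continuity then gives equality at each
  point.\<close>

lemma fourier_inversion: "complex_of_real (g y) = inverse_transform y / of_real (2 * pi)"
proof -
  have fub: "complex_of_real (integral {a..b} g) = integral {a..b} (\<lambda>y. inverse_transform y / of_real (2 * pi))"
    if "a \<le> b" for a b
  proof -
    have "(\<integral>t. (iexp (- (t * a)) - iexp (- (t * b))) / (\<i> * t) * \<phi> t \<partial>lborel)
        = (\<integral>t. (\<integral>y. indicator {a..b} y *\<^sub>R (\<phi> t * iexp (- (t * y))) \<partial>lborel) \<partial>lborel)"
    proof (rule integral_cong_AE)
      have "(iexp (- (t * a)) - iexp (- (t * b))) / (\<i> * of_real t) * \<phi> t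
          = (\<integral>y. indicator {a..b} y *\<^sub>R (\<phi> t * iexp (- (t * y))) \<partial>lborel)" if "t \<noteq> 0" for t
      proof -
        have "(\<integral>y. indicator {a..b} y *\<^sub>R (\<phi> t * iexp (- (t * y))) \<partial>lborel)
            = (\<integral>y. \<phi> t * (indicator {a..b} y *\<^sub>R iexp (- (t * y))) \<partial>lborel)"
          by (intro Bochner_Integration.integral_cong) auto
        also have "\<dots> = \<phi> t * (\<integral>y. indicator {a..b} y *\<^sub>R iexp (- (t * y)) \<partial>lborel)"
          by (rule integral_mult_right_zero)
        finally show ?thesis using integral_iexp_Icc[OF \<open>a \<le> b\<close> that] by simp
      qed
      \<comment> \<open>The kernel takes the default value 0 at t = 0, so the identity is claimed
        off this null set.\<close>
      then show "AE t in lborel. (iexp (- (t * a)) - iexp (- (t * b))) / (\<i> * of_real t) * \<phi> t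
          = (\<integral>y. indicator {a..b} y *\<^sub>R (\<phi> t * iexp (- (t * y))) \<partial>lborel)"
        using AE_lborel_singleton[of "0::real"] by (auto elim!: eventually_mono)
    qed measurable
    also have "\<dots> = (\<integral>y. (\<integral>t. indicator {a..b} y *\<^sub>R (\<phi> t * iexp (- (t * y))) \<partial>lborel) \<partial>lborel)"
    proof (rule lborel_pair.Fubini_integral)
      show "integrable (lborel \<Otimes>\<^sub>M lborel) (\<lambda>(y, t). indicator {a..b} y *\<^sub>R (\<phi> t * iexp (- (t * y))))"
      proof (rule lborel_pair.Fubini_integrable)
        have "(\<integral>t. norm (case (y, t) of (y, t) \<Rightarrow> indicator {a..b} y *\<^sub>R (\<phi> t * iexp (- (t * y)))) \<partial>lborel)
            = indicator {a..b} y * (\<integral>t. norm (\<phi> t) \<partial>lborel)" for y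
          by (auto simp: norm_mult indicator_def)
        then show "integrable lborel (\<lambda>y. \<integral>t. norm (case (y, t) of (y, t) \<Rightarrow> indicator {a..b} y *\<^sub>R (\<phi> t * iexp (- (t * y)))) \<partial>lborel)"
          by (simp only:) (intro integrable_mult_left integrable_real_indicator; simp add: that)
        show "AE y in lborel. integrable lborel (\<lambda>t. case (y, t) of (y, t) \<Rightarrow> indicator {a..b} y *\<^sub>R (\<phi> t * iexp (- (t * y))))"
          using integrable_\<phi>_iexp by (intro AE_I2) simp
      qed measurable
    qed
    also have "\<dots> = (\<integral>y. indicator {a..b} y *\<^sub>R inverse_transform y \<partial>lborel)"
      unfolding inverse_transform_def by simp
    also have "\<dots> = integral {a..b} inverse_transform"
    proof -
      have "set_integrable lborel {a..b} inverse_transform"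
        by (intro borel_integrable_atLeastAtMost' continuous_on_subset[OF continuous_inverse_transform]) auto
      from set_borel_integral_eq_integral(2)[OF this] show ?thesis
        by (simp add: set_lebesgue_integral_def)
    qed
    finally show ?thesis
      unfolding fourier_inversion_Ioc[OF that] by simp
  qed
  have int_h: "(\<lambda>y. inverse_transform y / of_real (2 * pi)) integrable_on {a..b}" for a b
    by (intro integrable_continuous_real continuous_intros continuous_on_subset[OF continuous_inverse_transform]) auto
  \<comment> \<open>The inverse transform is complex a priori. Real and imaginary parts are compared
    separately, and the second comparison, with 0, shows that it is real.\<close>
  have Re_eq: "g y = Re (inverse_transform y / of_real (2 * pi))" for y
  proof (rule continuous_eqI_integral[OF cont])
    show "continuous_on UNIV (\<lambda>y. Re (inverse_transform y / of_real (2 * pi)))"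
      by (intro continuous_intros continuous_inverse_transform) auto
    show "integral {a..b} g = integral {a..b} (\<lambda>y. Re (inverse_transform y / of_real (2 * pi)))" if "a \<le> b" for a b
      using arg_cong[OF fub[OF that], of Re] integral_linear[OF int_h[of a b] bounded_linear_Re] by (simp add: o_def)
  qed
  have Im_eq: "0 = Im (inverse_transform y / of_real (2 * pi))" for y
  proof (rule continuous_eqI_integral[where f = "\<lambda>_. 0" and x = y
        and g = "\<lambda>y. Im (inverse_transform y / of_real (2 * pi))"])
    show "continuous_on UNIV (\<lambda>_. 0 :: real)" by simp
    show "continuous_on UNIV (\<lambda>y. Im (inverse_transform y / of_real (2 * pi)))"
      by (intro continuous_intros continuous_inverse_transform) auto
    show "integral {a..b} (\<lambda>_. 0) = integral {a..b} (\<lambda>y. Im (inverse_transform y / of_real (2 * pi)))" if "a \<le> b" for a b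
      using arg_cong[OF fub[OF that], of Im] integral_linear[OF int_h[of a b] bounded_linear_Im] by (simp add: o_def)
  qed
  show ?thesis
    using Re_eq Im_eq by (intro complex_eqI) (simp_all only: complex.sel Re_complex_of_real Im_complex_of_real)
qed

text \<open>Symmetric truncation is the form matched by the vertical sides of finite rectangles in
  the contour argument.\<close>

lemma fourier_inversion_LIMSEQ:
  assumes "continuous_on UNIV \<phi>"
  shows "(\<lambda>n. integral {-real n..real n} (\<lambda>t. \<phi> t * iexp (- (t * y))) / of_real (2 * pi)) \<longlonglongrightarrow> of_real (g y)"
  unfolding fourier_inversion
proof (rule tendsto_divide[OF _ tendsto_const])
  let ?f = "\<lambda>t. \<phi> t * iexp (- (t * y))"
  have "(\<lambda>n. \<integral>t. indicator {-real n..real n} t *\<^sub>R ?f t \<partial>lborel) \<longlonglongrightarrow> (\<integral>t. ?f t \<partial>lborel)"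
  proof (rule integral_dominated_convergence[where w = "\<lambda>t. norm (\<phi> t)"])
    show "AE t in lborel. (\<lambda>n. indicator {-real n..real n} t *\<^sub>R ?f t) \<longlonglongrightarrow> ?f t"
    proof (rule AE_I2)
      fix t :: real
      have "eventually (\<lambda>n. indicator {-real n..real n} t *\<^sub>R ?f t = ?f t) sequentially"
        using eventually_gt_at_top[of "nat \<lceil>\<bar>t\<bar>\<rceil>"]
      proof eventually_elim
        case (elim n)
        then have "\<bar>t\<bar> < real n" by linarith
        then have "t \<in> {-real n..real n}" by auto
        then show ?case by simp
      qed
      then show "(\<lambda>n. indicator {-real n..real n} t *\<^sub>R ?f t) \<longlonglongrightarrow> ?f t"
        by (rule tendsto_eventually)
    qed
  qed (use int_\<phi> in \<open>auto simp: norm_mult indicator_def\<close>)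
  moreover have "(\<integral>t. indicator {-real n..real n} t *\<^sub>R ?f t \<partial>lborel) = integral {-real n..real n} ?f" for n
  proof -
    have "set_integrable lborel {-real n..real n} ?f"
      by (intro borel_integrable_atLeastAtMost' continuous_intros continuous_on_subset[OF assms]) auto
    from set_borel_integral_eq_integral(2)[OF this] show ?thesis
      by (simp add: set_lebesgue_integral_def)
  qed
  ultimately show "(\<lambda>n. integral {-real n..real n} ?f) \<longlonglongrightarrow> inverse_transform y"
    by (simp add: inverse_transform_def)
qed auto

end

section \<open>Shifting the contour\<close>

text \<open>This is minus the residue of F(s) exp (- s y) at \<rho>. One sign comes from moving the
  line of integration to the right past the pole, the other l signs from the powers of -y in the
  exponential series.\<close>

definition pole_term :: "(complex \<Rightarrow> complex) \<Rightarrow> real \<Rightarrow> real \<Rightarrow> complex" where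
  "pole_term F \<rho> y = (\<Sum>l<pole_order F (of_real \<rho>).
     (-1) ^ (l + 1) * sing_coeff F (l + 1) (of_real \<rho>) / fact l * of_real (exp (- \<rho> * y) * y ^ l))"

text \<open>About \<rho> the exponential is exp (- \<rho> y) times the series of (-y)^l w^l / l!, so
  the coefficient of 1/w in the product pairs c_{l+1} with the l-th term.\<close>

lemma residue_times_exp:
  assumes mero: "F meromorphic_on {of_real \<rho>}" and pole: "is_pole F (of_real \<rho>)"
  shows "residue (\<lambda>s. F s * exp (- (s * of_real y))) (of_real \<rho>) = - pole_term F \<rho> y"
proof -
  define z where "z = complex_of_real \<rho>"
  define L where "L = laurent_expansion F z"
  have L: "(\<lambda>w. F (z + w)) has_laurent_expansion L"
    unfolding L_def z_def by (rule meromorphic_on_imp_has_laurent_expansion[OF mero]) simp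
  have neg: "fls_subdegree L < 0"
    using is_pole_imp_neg_fls_subdegree[OF L] pole by (simp add: z_def)
  then have L0: "L \<noteq> 0" by auto
  have zo: "zorder F z = fls_subdegree L" by (rule has_laurent_expansion_zorder[OF L L0])
  define N where "N = pole_order F z"
  have N: "int N = - fls_subdegree L" using neg by (simp add: N_def pole_order_def zo)
  define G where "G = fps_const (exp (- (z * of_real y))) * fps_exp (- complex_of_real y)"
  have "(\<lambda>w. exp (- (z * of_real y)) * exp (- of_real y * w)) has_fps_expansion G"
    unfolding G_def by (intro fps_expansion_intros)
  also have "(\<lambda>w. exp (- (z * of_real y)) * exp (- of_real y * w)) = (\<lambda>w. exp (- ((z + w) * of_real y)))"
    by (rule ext) (simp add: algebra_simps flip: exp_add)
  finally have G: "(\<lambda>w. exp (- ((z + w) * of_real y))) has_laurent_expansion fps_to_fls G"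
    by (rule has_laurent_expansion_fps)
  have G_nth: "fps_nth G n = exp (- (z * of_real y)) * (- of_real y) ^ n / fact n" for n
    by (simp add: G_def)
  \<comment> \<open>The exponential has a non-zero constant term. Subdegree 0 fixes the upper limit
    -1 in the coefficient formula for the product.\<close>
  have sdG: "fls_subdegree (fps_to_fls G) = 0"
    by (subst fls_subdegree_fls_to_fps) (simp add: subdegree_eq_0_iff G_nth)
  have "residue (\<lambda>s. F s * exp (- (s * of_real y))) z = fls_residue (L * fps_to_fls G)"
    by (intro has_laurent_expansion_residue has_laurent_expansion_mult L G)
  also have "\<dots> = (\<Sum>i = fls_subdegree L..-1. fls_nth L i * fls_nth (fps_to_fls G) (-1 - i))"
    using fls_times_nth(2)[of L "fps_to_fls G" "- 1"] by (simp only: sdG diff_zero fls_residue_def)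
  also have "\<dots> = (\<Sum>l<N. fls_nth L (- int (l + 1)) * fps_nth G l)"
    \<comment> \<open>The Laurent index i = -(l + 1) runs from -N to -1, hence l runs from 0 to N -
      1.\<close>
    by (rule sum.reindex_bij_witness[of _ "\<lambda>l. - int (l + 1)" "\<lambda>i. nat (-1 - i)"]) (use N in auto)
  also have "\<dots> = - pole_term F \<rho> y"
    unfolding pole_term_def G_nth sum_negf [symmetric] N_def z_def
  proof (intro sum.cong refl)
    fix l
    have "(- complex_of_real y) ^ l = (-1) ^ l * of_real (y ^ l)"
      by (metis mult_minus1 of_real_power power_mult_distrib)
    then show "fls_nth L (- int (l + 1)) * (exp (- (of_real \<rho> * of_real y)) * (- of_real y) ^ l / fact l) =
      - ((- 1) ^ (l + 1) * sing_coeff F (l + 1) (of_real \<rho>) / fact l * of_real (exp (- \<rho> * y) * y ^ l))"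
      by (simp add: sing_coeff_def L_def z_def exp_of_real [symmetric])
  qed
  finally show ?thesis by (simp add: z_def)
qed

locale vertical_decay =
  fixes F :: "complex \<Rightarrow> complex" and \<delta> :: real
  assumes mero: "F nicely_meromorphic_on UNIV"
    and poles_real: "\<And>z. is_pole F z \<Longrightarrow> Im z = 0"
    and \<delta>: "\<delta> > 0" and rate: "vertical_rate F (- \<delta>)"
begin

text \<open>Poles of a meromorphic function do not accumulate and the segment is compact. Finiteness
  gives the sums over poles their meaning, as a sum over an infinite set is 0 by default.\<close>

lemma finite_real_poles: "finite {\<rho>. u \<le> \<rho> \<and> \<rho> \<le> v \<and> is_pole F (of_real \<rho>)}"
proof -
  have mero': "F meromorphic_on UNIV" using mero by (simp add: nicely_meromorphic_on_def)
  have "finite ((of_real ` {u..v}) \<inter> {w. is_pole F w})"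
  proof (rule finite_not_islimpt_in_compact)
    show "compact (complex_of_real ` {u..v})"
      by (intro compact_continuous_image continuous_intros) auto
    fix z :: complex
    have "isolated_singularity_at F z"
      by (rule meromorphic_on_isolated_singularity[OF meromorphic_on_subset[OF mero']]) simp
    then show "\<not> z islimpt {w. is_pole F w}" by (rule not_islimpt_poles)
  qed
  moreover have "complex_of_real ` {\<rho>. u \<le> \<rho> \<and> \<rho> \<le> v \<and> is_pole F (of_real \<rho>)} \<subseteq> (of_real ` {u..v}) \<inter> {w. is_pole F w}"
    by auto
  ultimately have "finite (complex_of_real ` {\<rho>. u \<le> \<rho> \<and> \<rho> \<le> v \<and> is_pole F (of_real \<rho>)})"
    by (rule finite_subset[rotated])
  then show ?thesis
    by (rule finite_imageD) (simp add: inj_on_def)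
qed

lemma not_pole_vertical:
  assumes "\<not> is_pole F (of_real c)"
  shows "\<not> is_pole F (Complex c t)"
proof
  assume *: "is_pole F (Complex c t)"
  from poles_real[OF this] have "Complex c t = of_real c" by (simp add: complex_eq_iff)
  with * assms show False by simp
qed

lemma continuous_vertical:
  assumes "\<not> is_pole F (of_real c)"
  shows "continuous_on S (\<lambda>t. F (Complex c t))"
proof (rule continuous_at_imp_continuous_on, rule ballI)
  fix t
  have "isCont F (Complex c t)"
    by (intro analytic_at_imp_isCont nicely_meromorphic_on_imp_analytic_at[OF mero]
              not_pole_vertical[OF assms]) simp
  moreover have "isCont (\<lambda>t. Complex c t) t"
    unfolding Complex_eq by (intro continuous_intros)
  ultimately show "isCont (\<lambda>t. F (Complex c t)) t"
    by (rule isCont_o2[rotated])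
qed

text \<open>The exponential decay is weakened to 1 / (1 + t^2), whose integral over the line is
  finite and explicit, namely pi.\<close>

lemma vertical_bound:
  assumes "\<not> is_pole F (of_real c)"
  obtains B where "B \<ge> 0" "\<And>t. norm (F (Complex c t)) \<le> B * inverse (1 + t\<^sup>2)"
proof -
  have "\<delta> / 2 > 0" using \<delta> by simp
  then obtain A T where A: "A \<ge> 0" "\<And>x t. c \<le> x \<Longrightarrow> x \<le> c \<Longrightarrow> T \<le> \<bar>t\<bar> \<Longrightarrow>
      norm (F (Complex x t)) \<le> A * exp ((- \<delta> + \<delta> / 2) * \<bar>t\<bar>)"
    using vertical_rateE[OF rate, of "\<delta> / 2" c c] by metis
  obtain A' where A': "A' \<ge> 0" "\<And>t. t \<ge> 0 \<Longrightarrow> (1 + t) ^ 2 \<le> A' * exp (\<delta> / 2 * t)"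
    using power_le_exp_bound[OF \<open>\<delta> / 2 > 0\<close>, of 1 2] by metis
  have "compact ((\<lambda>t. F (Complex c t)) ` {-T..T})"
    by (intro compact_continuous_image continuous_vertical[OF assms]) auto
  then obtain B where B: "\<And>t. t \<in> {-T..T} \<Longrightarrow> norm (F (Complex c t)) \<le> B"
    using compact_imp_bounded bounded_iff by (metis imageI)
  \<comment> \<open>The first summand covers large heights, the second the compact middle part. The
    absolute value guards against a negative \<open>B\<close>, possible when the interval from -T to
    T is empty.\<close>
  define M where "M = A * A' + \<bar>B\<bar> * (1 + T\<^sup>2)"
  have "norm (F (Complex c t)) \<le> M * inverse (1 + t\<^sup>2)" for t
  proof -
    have pos: "1 + t\<^sup>2 > 0" by (simp add: add_pos_nonneg)
    have "norm (F (Complex c t)) * (1 + t\<^sup>2) \<le> M"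
    proof (cases "T \<le> \<bar>t\<bar>")
      case True
      have "1 + t\<^sup>2 \<le> (1 + \<bar>t\<bar>) ^ 2" by (simp add: power2_eq_square algebra_simps)
      also have "\<dots> \<le> A' * exp (\<delta> / 2 * \<bar>t\<bar>)" by (rule A') simp
      finally have "norm (F (Complex c t)) * (1 + t\<^sup>2)
          \<le> (A * exp ((- \<delta> + \<delta> / 2) * \<bar>t\<bar>)) * (A' * exp (\<delta> / 2 * \<bar>t\<bar>))"
        using A True pos by (intro mult_mono) auto
      also have "\<dots> = A * A' * (exp ((- \<delta> + \<delta> / 2) * \<bar>t\<bar>) * exp (\<delta> / 2 * \<bar>t\<bar>))"
        by (simp only: mult_ac)
      also have "exp ((- \<delta> + \<delta> / 2) * \<bar>t\<bar>) * exp (\<delta> / 2 * \<bar>t\<bar>) = 1"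
        by (simp add: field_simps flip: exp_add)
      finally show ?thesis by (simp add: M_def add_increasing2)
    next
      case False
      have "norm (F (Complex c t)) * (1 + t\<^sup>2) \<le> \<bar>B\<bar> * (1 + T\<^sup>2)"
      proof (rule mult_mono)
        have "norm (F (Complex c t)) \<le> B" using False by (intro B) auto
        then show "norm (F (Complex c t)) \<le> \<bar>B\<bar>" by simp
        have "t\<^sup>2 \<le> T\<^sup>2" using False by (simp add: abs_le_square_iff [symmetric])
        then show "1 + t\<^sup>2 \<le> 1 + T\<^sup>2" by simp
      qed (use pos in auto)
      also have "\<dots> \<le> M" using A(1) A'(1) by (simp add: M_def)
      finally show ?thesis .
    qed
    then show ?thesis using pos by (simp add: field_simps)
  qed
  moreover have "M \<ge> 0" using A(1) A'(1) by (simp add: M_def)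
  ultimately show ?thesis using that by blast
qed

lemma norm_exp_vertical: "norm (exp (- (Complex x t * of_real y))) = exp (- x * y)"
  by (simp add: norm_exp_eq_Re)

text \<open>The bound is uniform in T because arctan T - arctan (-T) never exceeds pi.\<close>

lemma vertical_integral_bound:
  assumes c: "\<not> is_pole F (of_real c)" and B: "B \<ge> 0" "\<And>t. norm (F (Complex c t)) \<le> B * inverse (1 + t\<^sup>2)"
    and "T > 0"
  shows "norm (integral {-T..T} (\<lambda>t. F (Complex c t) * exp (- (Complex c t * of_real y)))) \<le> B * pi * exp (- c * y)"
proof -
  have "((\<lambda>t. inverse (1 + t\<^sup>2)) has_integral (arctan T - arctan (- T))) {-T..T}"
    using \<open>T > 0\<close>
    by (intro fundamental_theorem_of_calculus)
       (auto simp flip: has_real_derivative_iff_has_vector_derivative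
             intro!: derivative_eq_intros)
  then have arc: "((\<lambda>t. B * exp (- c * y) * inverse (1 + t\<^sup>2)) has_integral (B * exp (- c * y) * (arctan T - arctan (- T)))) {-T..T}"
    by (rule has_integral_mult_right)
  have "norm (integral {-T..T} (\<lambda>t. F (Complex c t) * exp (- (Complex c t * of_real y))))
      \<le> integral {-T..T} (\<lambda>t. B * exp (- c * y) * inverse (1 + t\<^sup>2))"
  proof (rule integral_norm_bound_integral)
    show "(\<lambda>t. F (Complex c t) * exp (- (Complex c t * of_real y))) integrable_on {-T..T}"
      by (intro integrable_continuous_real continuous_intros continuous_vertical[OF c])
    show "(\<lambda>t. B * exp (- c * y) * inverse (1 + t\<^sup>2)) integrable_on {-T..T}"
      using arc by blast
    show "norm (F (Complex c t) * exp (- (Complex c t * of_real y))) \<le> B * exp (- c * y) * inverse (1 + t\<^sup>2)" for t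
      using mult_right_mono[OF B(2)[of t], of "exp (- c * y)"]
      by (simp add: norm_mult norm_exp_vertical mult_ac)
  qed
  also have "\<dots> = B * exp (- c * y) * (arctan T - arctan (- T))"
    using arc by (rule integral_unique)
  also have "\<dots> \<le> B * exp (- c * y) * pi"
    using arctan_bounded[of T] B(1) by (intro mult_left_mono) (auto simp: arctan_minus)
  finally show ?thesis by (simp add: mult_ac)
qed

text \<open>The residue theorem for the rectangle, solved for its left side: the right side is the
  shifted integral, and the two horizontal sides form the error that disappears as T grows.\<close>

lemma rectangle_residues:
  assumes "c < \<sigma>" "T > 0" and c: "\<not> is_pole F (of_real c)" and \<sigma>: "\<not> is_pole F (of_real \<sigma>)"
  defines "g \<equiv> \<lambda>y s. F s * exp (- (s * of_real y))"
  shows "integral {-T..T} (\<lambda>t. g y (Complex c t)) / of_real (2 * pi)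
       - (\<Sum>\<rho> | c \<le> \<rho> \<and> \<rho> \<le> \<sigma> \<and> is_pole F (of_real \<rho>). pole_term F \<rho> y)
     = integral {-T..T} (\<lambda>t. g y (Complex \<sigma> t)) / of_real (2 * pi)
       + (contour_integral (linepath (Complex c (-T)) (Complex \<sigma> (-T))) (g y)
         - contour_integral (linepath (Complex c T) (Complex \<sigma> T)) (g y)) / (2 * pi * \<i>)"
proof -
  let ?a = "Complex c (-T)" and ?b = "Complex \<sigma> T"
  define P where "P = {\<rho>. c \<le> \<rho> \<and> \<rho> \<le> \<sigma> \<and> is_pole F (of_real \<rho>)}"
  have finP: "finite P" unfolding P_def by (rule finite_real_poles)
  have "path_image (rectpath ?a ?b) \<subseteq> cbox ?a ?b - complex_of_real ` P"
    using \<open>c < \<sigma>\<close> \<open>T > 0\<close> c \<sigma> by (auto simp: path_image_rectpath in_cbox_complex_iff P_def)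
  have F_ana: "F analytic_on {z}" if "\<not> is_pole F z" for z
    by (rule nicely_meromorphic_on_imp_analytic_at[OF mero]) (use that in auto)
  have analytic: "g y analytic_on {z}" if "\<not> is_pole F z" for z
    unfolding g_def by (intro analytic_intros F_ana that)
  have cont: "continuous_on S (g y)" if "\<And>z. z \<in> S \<Longrightarrow> \<not> is_pole F z" for S
    by (intro continuous_at_imp_continuous_on ballI analytic_at_imp_isCont analytic that)
  \<comment> \<open>The residue theorem divided by 2 pi \<i>, where p = 2 pi, B and U are the bottom
    and top integrals, and Is and Ic those over the right and left sides, with ds = \<i> dt.\<close>
  have solve: "Ic / p - S = Is / p + (B - U) / (p * \<i>)"
    if "- (p * \<i> * S) = B + \<i> * Is + - U + - (\<i> * Ic)" "p \<noteq> 0" for p S B Is U Ic :: complex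
  proof -
    have eq: "\<i> * Ic = B - U + \<i> * Is + p * \<i> * S" using that(1) by (simp add: algebra_simps)
    have "Ic / p - S = (\<i> * Ic - p * \<i> * S) / (p * \<i>)"
      using that(2) by (simp add: diff_divide_distrib)
    also have "\<dots> = (\<i> * Is + (B - U)) / (p * \<i>)" unfolding eq by simp
    also have "\<dots> = Is / p + (B - U) / (p * \<i>)" by (simp add: add_divide_distrib)
    finally show ?thesis .
  qed
  have finite_lower: "\<exists>e>0. \<forall>d\<in>D. e \<le> d" if "finite D" "\<forall>d\<in>D. 0 < d" for D :: "real set"
    \<comment> \<open>Inserting 1 makes the minimum meaningful even if the set is empty.\<close>
    using that by (intro exI[of _ "Min (insert 1 D)"]) (auto simp: Min_gr_iff)
  text \<open>The residue theorem wants an open set containing the rectangle but no further poles.\<close>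
  have "\<exists>S. open S \<and> connected S \<and> cbox ?a ?b \<subseteq> S \<and> (\<forall>z\<in>S. is_pole F z \<longrightarrow> z \<in> of_real ` P)"
  proof -
    \<comment> \<open>These are the poles within distance 1 of the interval from c to \<sigma> but
      outside it. Their distance to the interval is the maximum of c - \<rho> and \<rho> - \<sigma>;
      finitely many of them leave a positive gap e.\<close>
    let ?Q = "{\<rho>. c - 1 \<le> \<rho> \<and> \<rho> \<le> \<sigma> + 1 \<and> is_pole F (of_real \<rho>)} - P"
    have "finite ?Q" using finite_real_poles by blast
    then have "finite ((\<lambda>\<rho>. max (c - \<rho>) (\<rho> - \<sigma>)) ` ?Q)" by blast
    moreover have "\<forall>d\<in>(\<lambda>\<rho>. max (c - \<rho>) (\<rho> - \<sigma>)) ` ?Q. 0 < d"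
      by (auto simp: P_def)
    ultimately obtain e where e: "e > 0" "\<forall>d\<in>(\<lambda>\<rho>. max (c - \<rho>) (\<rho> - \<sigma>)) ` ?Q. e \<le> d"
      using finite_lower by meson
    \<comment> \<open>Being at most 1, the margin stays in the range where the poles were
      counted.\<close>
    define e' where "e' = min e 1"
    let ?S = "box (Complex (c - e') (- T - 1)) (Complex (\<sigma> + e') (T + 1))"
    have "cbox ?a ?b \<subseteq> ?S"
      using e by (auto simp: in_cbox_complex_iff in_box_complex_iff e'_def)
    moreover have "z \<in> of_real ` P" if "z \<in> ?S" "is_pole F z" for z
    proof -
      have z: "z = of_real (Re z)" using poles_real[OF that(2)] by (simp add: complex_eq_iff)
      have "Re z \<in> P"
      proof (rule ccontr)
        assume "Re z \<notin> P"
        then have "Re z \<in> ?Q" using that z by (auto simp: in_box_complex_iff e'_def)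
        then have "e \<le> max (c - Re z) (Re z - \<sigma>)" using e by blast
        then show False using that by (auto simp: in_box_complex_iff e'_def)
      qed
      then show ?thesis using z by blast
    qed
    ultimately show ?thesis
      using convex_connected[OF convex_box(2)] open_box by blast
  qed
  then obtain S where S: "open S" "connected S" "cbox ?a ?b \<subseteq> S" "\<And>z. z \<in> S \<Longrightarrow> is_pole F z \<Longrightarrow> z \<in> of_real ` P"
    by blast
  have "contour_integral (rectpath ?a ?b) (g y)
      = 2 * pi * \<i> * (\<Sum>p\<in>of_real ` P. winding_number (rectpath ?a ?b) p * residue (g y) p)"
  proof (rule Residue_theorem)
    show "g y holomorphic_on S - of_real ` P"
    proof (rule analytic_imp_holomorphic)
      show "g y analytic_on S - of_real ` P"
        by (subst analytic_on_analytic_at) (use S(4) analytic in blast)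
    qed
    show "path_image (rectpath ?a ?b) \<subseteq> S - of_real ` P"
      using \<open>path_image (rectpath ?a ?b) \<subseteq> cbox ?a ?b - of_real ` P\<close> S(3) by blast
    show "\<forall>z. z \<notin> S \<longrightarrow> winding_number (rectpath ?a ?b) z = 0"
    proof (intro allI impI winding_number_zero_outside)
      show "path_image (rectpath ?a ?b) \<subseteq> cbox ?a ?b"
        using \<open>c < \<sigma>\<close> \<open>T > 0\<close> by (intro path_image_rectpath_subset_cbox) auto
    qed (use S(3) in auto)
  qed (use S finP in auto)
  also have "(\<Sum>p\<in>of_real ` P. winding_number (rectpath ?a ?b) p * residue (g y) p) = (\<Sum>\<rho>\<in>P. - pole_term F \<rho> y)"
  proof (subst sum.reindex)
    show "inj_on complex_of_real P" by (simp add: inj_on_def)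
    have "winding_number (rectpath ?a ?b) (of_real \<rho>) * residue (g y) (of_real \<rho>) = - pole_term F \<rho> y" if "\<rho> \<in> P" for \<rho>
    proof -
      have pole: "is_pole F (of_real \<rho>)" and "c \<noteq> \<rho>" "\<rho> \<noteq> \<sigma>" "c \<le> \<rho>" "\<rho> \<le> \<sigma>"
        using that c \<sigma> by (auto simp: P_def)
      then have "complex_of_real \<rho> \<in> box ?a ?b"
        using \<open>T > 0\<close> by (simp add: in_box_complex_iff)
      then have "winding_number (rectpath ?a ?b) (of_real \<rho>) = 1" by (rule winding_number_rectpath)
      moreover have "F meromorphic_on {of_real \<rho>}"
        using mero by (auto simp: nicely_meromorphic_on_def intro: meromorphic_on_subset)
      then have "residue (g y) (of_real \<rho>) = - pole_term F \<rho> y"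
        unfolding g_def using pole by (rule residue_times_exp)
      ultimately show ?thesis by simp
    qed
    then show "sum ((\<lambda>p. winding_number (rectpath ?a ?b) p * residue (g y) p) \<circ> of_real) P = (\<Sum>\<rho>\<in>P. - pole_term F \<rho> y)"
      by simp
  qed
  finally have res: "contour_integral (rectpath ?a ?b) (g y) = - (2 * pi * \<i> * (\<Sum>\<rho>\<in>P. pole_term F \<rho> y))"
    by (simp add: sum_negf)
  have off: "\<not> is_pole F z" if "z \<in> path_image (rectpath ?a ?b)" for z
    using \<open>path_image (rectpath ?a ?b) \<subseteq> cbox ?a ?b - of_real ` P\<close> S(3,4) that by blast
  have img: "path_image (rectpath ?a ?b) = closed_segment ?a (Complex \<sigma> (-T)) \<union> closed_segment (Complex \<sigma> (-T)) ?b
      \<union> closed_segment ?b (Complex c T) \<union> closed_segment (Complex c T) ?a"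
    by (simp add: rectpath_def Let_def path_image_join Un_assoc)
  have contg: "continuous_on (closed_segment ?a (Complex \<sigma> (-T))) (g y)"
      "continuous_on (closed_segment (Complex \<sigma> (-T)) ?b) (g y)"
      "continuous_on (closed_segment ?b (Complex c T)) (g y)"
      "continuous_on (closed_segment (Complex c T) ?a) (g y)"
    using off img by (auto intro!: cont)
  note intg = contg[THEN contour_integrable_continuous_linepath]
  have "contour_integral (rectpath ?a ?b) (g y) = contour_integral (linepath ?a (Complex \<sigma> (-T))) (g y)
      + contour_integral (linepath (Complex \<sigma> (-T)) ?b) (g y) + contour_integral (linepath ?b (Complex c T)) (g y)
      + contour_integral (linepath (Complex c T) ?a) (g y)"
    using intg by (simp add: rectpath_def Let_def)
  also have "contour_integral (linepath (Complex \<sigma> (-T)) ?b) (g y) = \<i> * integral {-T..T} (\<lambda>t. g y (Complex \<sigma> t))"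
    using \<open>T > 0\<close> by (intro contour_integral_linepath_same_Re) auto
  also have "contour_integral (linepath ?b (Complex c T)) (g y) = - contour_integral (linepath (Complex c T) ?b) (g y)"
    by (rule contour_integral_reverse_linepath[OF contg(3)])
  also have "contour_integral (linepath (Complex c T) ?a) (g y) = - contour_integral (linepath ?a (Complex c T)) (g y)"
    by (rule contour_integral_reverse_linepath[OF contg(4)])
  also have "contour_integral (linepath ?a (Complex c T)) (g y) = \<i> * integral {-T..T} (\<lambda>t. g y (Complex c t))"
    using \<open>T > 0\<close> by (intro contour_integral_linepath_same_Re) auto
  finally show ?thesis
    unfolding res P_def [symmetric] using solve[of "of_real (2 * pi)"] by (simp add: mult.assoc)
qed


text \<open>The factor growing with |y| is harmless: the height tends to infinity for fixed
  y.\<close>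

lemma horizontal_integral_bound:
  assumes "c < \<sigma>"
  obtains A T where "A \<ge> 0" "\<And>t y. T \<le> \<bar>t\<bar> \<Longrightarrow>
    norm (contour_integral (linepath (Complex c t) (Complex \<sigma> t)) (\<lambda>s. F s * exp (- (s * of_real y))))
      \<le> A * exp ((\<bar>c\<bar> + \<bar>\<sigma>\<bar>) * \<bar>y\<bar>) * exp (- (\<delta> / 2 * \<bar>t\<bar>))"
proof -
  have "\<delta> / 2 > 0" using \<delta> by simp
  then obtain A T where A: "A \<ge> 0" "\<And>x t. c \<le> x \<Longrightarrow> x \<le> \<sigma> \<Longrightarrow> T \<le> \<bar>t\<bar> \<Longrightarrow>
      norm (F (Complex x t)) \<le> A * exp ((- \<delta> + \<delta> / 2) * \<bar>t\<bar>)"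
    using vertical_rateE[OF rate, of "\<delta> / 2" c \<sigma>] by metis
  have "norm (contour_integral (linepath (Complex c t) (Complex \<sigma> t)) (\<lambda>s. F s * exp (- (s * of_real y))))
      \<le> (A * (\<sigma> - c)) * exp ((\<bar>c\<bar> + \<bar>\<sigma>\<bar>) * \<bar>y\<bar>) * exp (- (\<delta> / 2 * \<bar>t\<bar>))"
    \<comment> \<open>Height at least 1 keeps the segment off the real axis and hence off all
      poles.\<close>
    if t: "max T 1 \<le> \<bar>t\<bar>" for t y
  proof -
    let ?g = "\<lambda>s. F s * exp (- (s * of_real y))"
    let ?B = "A * exp (- (\<delta> / 2 * \<bar>t\<bar>)) * exp ((\<bar>c\<bar> + \<bar>\<sigma>\<bar>) * \<bar>y\<bar>)"
    have seg: "\<exists>x. c \<le> x \<and> x \<le> \<sigma> \<and> z = Complex x t" if "z \<in> closed_segment (Complex c t) (Complex \<sigma> t)" for z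
      using that \<open>c < \<sigma>\<close> by (auto simp: closed_segment_same_Im closed_segment_eq_real_ivl complex_eq_iff)
    have "norm (contour_integral (linepath (Complex c t) (Complex \<sigma> t)) ?g) \<le> ?B * norm (Complex \<sigma> t - Complex c t)"
    proof (rule contour_integral_bound_linepath)
      show "?g contour_integrable_on linepath (Complex c t) (Complex \<sigma> t)"
      proof (intro contour_integrable_continuous_linepath continuous_at_imp_continuous_on ballI analytic_at_imp_isCont
          analytic_intros nicely_meromorphic_on_imp_analytic_at[OF mero])
        fix z assume "z \<in> closed_segment (Complex c t) (Complex \<sigma> t)"
        then show "\<not> is_pole F z" using seg poles_real[of z] t by fastforce
      qed auto
      show "0 \<le> ?B" using A by simp
      fix z assume "z \<in> closed_segment (Complex c t) (Complex \<sigma> t)"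
      then obtain x where x: "c \<le> x" "x \<le> \<sigma>" "z = Complex x t" using seg by blast
      have "- x * y \<le> \<bar>x\<bar> * \<bar>y\<bar>" by (metis abs_ge_self abs_minus_cancel abs_mult)
      also have "\<dots> \<le> (\<bar>c\<bar> + \<bar>\<sigma>\<bar>) * \<bar>y\<bar>" using x by (intro mult_right_mono) auto
      finally have "exp (- x * y) \<le> exp ((\<bar>c\<bar> + \<bar>\<sigma>\<bar>) * \<bar>y\<bar>)" by simp
      moreover have "norm (F z) \<le> A * exp (- (\<delta> / 2 * \<bar>t\<bar>))"
        using A(2)[of x t] x t by simp
      ultimately show "norm (?g z) \<le> ?B"
        unfolding norm_mult x(3) norm_exp_vertical using A(1) by (intro mult_mono) auto
    qed
    also have "Complex \<sigma> t - Complex c t = of_real (\<sigma> - c)" by (simp add: complex_eq_iff)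
    also have "?B * norm (complex_of_real (\<sigma> - c)) = (A * (\<sigma> - c)) * exp ((\<bar>c\<bar> + \<bar>\<sigma>\<bar>) * \<bar>y\<bar>) * exp (- (\<delta> / 2 * \<bar>t\<bar>))"
      using \<open>c < \<sigma>\<close> by (simp only: norm_of_real) (simp add: mult_ac)
    finally show ?thesis .
  qed
  moreover have "A * (\<sigma> - c) \<ge> 0" using A assms by simp
  ultimately show ?thesis using that by blast
qed

text \<open>Only the integral over Re s = \<sigma> survives in the limit, and it contributes exp (-
  \<sigma> y) with a constant independent of y. An arbitrary limit \<open>h\<close> keeps this
  separate from Fourier inversion.\<close>

lemma contour_shift:
  assumes "c < \<sigma>" and c: "\<not> is_pole F (of_real c)" and \<sigma>: "\<not> is_pole F (of_real \<sigma>)"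
  obtains K where "\<And>y h. (\<lambda>n. integral {-real n..real n} (\<lambda>t. F (Complex c t) * exp (- (Complex c t * of_real y)))
        / of_real (2 * pi)) \<longlonglongrightarrow> h \<Longrightarrow>
      norm (h - (\<Sum>\<rho> | c \<le> \<rho> \<and> \<rho> \<le> \<sigma> \<and> is_pole F (of_real \<rho>). pole_term F \<rho> y)) \<le> K * exp (- \<sigma> * y)"
proof -
  obtain B where B: "B \<ge> 0" "\<And>t. norm (F (Complex \<sigma> t)) \<le> B * inverse (1 + t\<^sup>2)"
    using vertical_bound[OF \<sigma>] by metis
  obtain A T where A: "A \<ge> 0" "\<And>t y. T \<le> \<bar>t\<bar> \<Longrightarrow>
    norm (contour_integral (linepath (Complex c t) (Complex \<sigma> t)) (\<lambda>s. F s * exp (- (s * of_real y))))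
      \<le> A * exp ((\<bar>c\<bar> + \<bar>\<sigma>\<bar>) * \<bar>y\<bar>) * exp (- (\<delta> / 2 * \<bar>t\<bar>))"
    by (rule horizontal_integral_bound[OF \<open>c < \<sigma>\<close>]) (rule that)
  \<comment> \<open>The constant is the bound B pi for the vertical integral, divided by 2
    pi.\<close>
  have "norm (h - (\<Sum>\<rho> | c \<le> \<rho> \<and> \<rho> \<le> \<sigma> \<and> is_pole F (of_real \<rho>). pole_term F \<rho> y)) \<le> (B / 2) * exp (- \<sigma> * y)"
    if h: "(\<lambda>n. integral {-real n..real n} (\<lambda>t. F (Complex c t) * exp (- (Complex c t * of_real y)))
        / of_real (2 * pi)) \<longlonglongrightarrow> h" for y h
  proof -
    let ?S = "\<Sum>\<rho> | c \<le> \<rho> \<and> \<rho> \<le> \<sigma> \<and> is_pole F (of_real \<rho>). pole_term F \<rho> y"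
    let ?I = "\<lambda>c n. integral {-real n..real n} (\<lambda>t. F (Complex c t) * exp (- (Complex c t * of_real y)))"
    let ?H = "\<lambda>t. contour_integral (linepath (Complex c t) (Complex \<sigma> t)) (\<lambda>s. F s * exp (- (s * of_real y)))"
    define M where "M = A * exp ((\<bar>c\<bar> + \<bar>\<sigma>\<bar>) * \<bar>y\<bar>)"
    have "(\<lambda>n. exp (- (\<delta> / 2)) ^ n) \<longlonglongrightarrow> 0"
      using \<delta> by (intro LIMSEQ_power_zero) simp
    then have "(\<lambda>n. exp (- (\<delta> / 2 * real n))) \<longlonglongrightarrow> 0"
      by (simp add: mult.commute flip: exp_of_nat_mult)
    then have "(\<lambda>n. (B / 2) * exp (- \<sigma> * y) + M * exp (- (\<delta> / 2 * real n)) / pi) \<longlonglongrightarrow> (B / 2) * exp (- \<sigma> * y) + M * 0 / pi"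
      by (intro tendsto_intros) auto
    moreover have "(\<lambda>n. norm (?I c n / of_real (2 * pi) - ?S)) \<longlonglongrightarrow> norm (h - ?S)"
      by (intro tendsto_intros h)
    moreover have "eventually (\<lambda>n. norm (?I c n / of_real (2 * pi) - ?S)
        \<le> (B / 2) * exp (- \<sigma> * y) + M * exp (- (\<delta> / 2 * real n)) / pi) sequentially"
      using eventually_gt_at_top[of "nat \<lceil>\<bar>T\<bar>\<rceil>"]
    proof eventually_elim
      case (elim n)
      then have n: "T \<le> real n" "real n > 0" by linarith+
      have "norm (?I c n / of_real (2 * pi) - ?S)
          = norm (?I \<sigma> n / of_real (2 * pi) + (?H (- real n) - ?H (real n)) / (2 * pi * \<i>))"
        by (subst rectangle_residues[OF \<open>c < \<sigma>\<close> n(2) c \<sigma>]) simp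
      also have "\<dots> \<le> norm (?I \<sigma> n / of_real (2 * pi)) + norm ((?H (- real n) - ?H (real n)) / (2 * pi * \<i>))"
        by (rule norm_triangle_ineq)
      also have "norm (?I \<sigma> n / of_real (2 * pi)) \<le> (B / 2) * exp (- \<sigma> * y)"
        using vertical_integral_bound[OF \<sigma> B n(2), of y] by (simp add: norm_divide field_simps)
      also have "norm ((?H (- real n) - ?H (real n)) / (2 * pi * \<i>)) \<le> M * exp (- (\<delta> / 2 * real n)) / pi"
      proof -
        have "norm (?H (- real n) - ?H (real n)) \<le> M * exp (- (\<delta> / 2 * real n)) + M * exp (- (\<delta> / 2 * real n))"
          using A(2)[of "- real n" y] A(2)[of "real n" y] n
          by (intro order.trans[OF norm_triangle_ineq4] add_mono) (auto simp: M_def)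
        then show ?thesis by (simp add: norm_divide norm_mult field_simps)
      qed
      finally show ?case by simp
    qed
    ultimately have "norm (h - ?S) \<le> (B / 2) * exp (- \<sigma> * y) + M * 0 / pi"
      by (intro tendsto_le[OF sequentially_bot])
    then show ?thesis by simp
  qed
  then show ?thesis using that by blast
qed

end

section \<open>Two-sided Laplace transforms\<close>

text \<open>The exponent has a positive sign, so that for the density of log X this is the moment of
  order z of X.\<close>

definition bilateral_laplace :: "(real \<Rightarrow> real) \<Rightarrow> complex \<Rightarrow> complex" where
  "bilateral_laplace f z = (\<integral>y. of_real (f y) * exp (z * of_real y) \<partial>lborel)"

lemma integrable_bilateral_laplace:
  assumes "f \<in> borel_measurable borel" "\<And>y. 0 \<le> f y" "integrable lborel (\<lambda>y. f y * exp (Re z * y))"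
  shows "integrable lborel (\<lambda>y. of_real (f y) * exp (z * of_real y))"
  by (rule Bochner_Integration.integrable_bound[OF assms(3)]) (use assms(1,2) in \<open>auto simp: norm_mult norm_exp_eq_Re\<close>)

lemma bilateral_laplace_of_real:
  "bilateral_laplace f (of_real s) = of_real (\<integral>y. f y * exp (s * y) \<partial>lborel)"
proof -
  have "complex_of_real (f y) * exp (of_real s * of_real y) = of_real (f y * exp (s * y))" for y
    by (simp only: of_real_mult exp_of_real [symmetric])
  then show ?thesis
    unfolding bilateral_laplace_def by (simp only: integral_complex_of_real)
qed

lemma norm_bilateral_laplace_le:
  assumes "\<And>y. 0 \<le> f y"
  shows "norm (bilateral_laplace f z) \<le> (\<integral>y. f y * exp (Re z * y) \<partial>lborel)"
  unfolding bilateral_laplace_def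
  by (rule order.trans[OF integral_norm_bound]) (use assms in \<open>simp add: norm_mult norm_exp_eq_Re\<close>)

text \<open>A dominating function for differentiation under the integral. The linear factor |y| is
  paid for by a second exp (r |y|), and the sum of two exponentials replaces exp (2 r |y|), so that
  only weights from the strip occur.\<close>

lemma norm_exp_diff_quotient_le:
  fixes h :: complex
  assumes "r > 0" "norm h \<le> r" "h \<noteq> 0"
  shows "norm ((exp (h * of_real y) - 1) / h) \<le> (exp (2 * r * y) + exp (- (2 * r * y))) / r"
proof -
  have "norm (exp (h * of_real y) - 1) \<le> exp \<bar>Re (h * of_real y)\<bar> * norm (h * of_real y)"
    using Taylor_exp[of "h * of_real y" 0] by simp
  also have "\<dots> \<le> exp (r * \<bar>y\<bar>) * (norm h * \<bar>y\<bar>)"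
  proof (rule mult_mono)
    have "\<bar>Re h\<bar> \<le> r" using abs_Re_le_cmod[of h] assms by linarith
    then show "exp \<bar>Re (h * of_real y)\<bar> \<le> exp (r * \<bar>y\<bar>)"
      by (simp add: abs_mult mult_right_mono)
  qed (auto simp: norm_mult)
  finally have "norm ((exp (h * of_real y) - 1) / h) \<le> exp (r * \<bar>y\<bar>) * \<bar>y\<bar>"
    using assms by (simp add: norm_divide field_simps)
  also have "\<dots> \<le> exp (r * \<bar>y\<bar>) * (exp (r * \<bar>y\<bar>) / r)"
  proof (rule mult_left_mono)
    have "r * \<bar>y\<bar> \<le> exp (r * \<bar>y\<bar>)"
      using exp_ge_add_one_self[of "r * \<bar>y\<bar>"] by linarith
    then show "\<bar>y\<bar> \<le> exp (r * \<bar>y\<bar>) / r" using assms by (simp add: field_simps)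
  qed simp
  also have "\<dots> = exp (2 * r * \<bar>y\<bar>) / r" by (simp flip: exp_add)
  also have "\<dots> \<le> (exp (2 * r * y) + exp (- (2 * r * y))) / r"
    using assms by (intro divide_right_mono) (auto simp: abs_if)
  finally show ?thesis .
qed

lemma holomorphic_bilateral_laplace:
  assumes borel [measurable]: "f \<in> borel_measurable borel" and nonneg: "\<And>y. 0 \<le> f y"
    and int: "\<And>s. u < s \<Longrightarrow> s < v \<Longrightarrow> integrable lborel (\<lambda>y. f y * exp (s * y))"
  shows "bilateral_laplace f holomorphic_on {z. u < Re z \<and> Re z < v}"
  unfolding holomorphic_on_def field_differentiable_def
proof (rule ballI)
  fix z assume "z \<in> {z. u < Re z \<and> Re z < v}"
  then have z: "u < Re z" "Re z < v" by auto
  \<comment> \<open>A third of the distance to the boundary leaves room for the weights at Re z - 2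
    r and Re z + 2 r.\<close>
  define r where "r = min (Re z - u) (v - Re z) / 3"
  have r: "r > 0" "u < Re z - 2 * r" "Re z + 2 * r < v" "u < Re z - r" "Re z + r < v"
    using z by (auto simp: r_def min_def field_simps)
  let ?L = "\<integral>y. of_real (f y) * exp (z * of_real y) * of_real y \<partial>lborel"
  have "((\<lambda>w. (bilateral_laplace f w - bilateral_laplace f z) / (w - z)) \<longlongrightarrow> ?L) (at z within ball z r)"
    unfolding tendsto_at_iff_sequentially
  proof (intro allI impI)
    fix X assume X: "\<forall>n. X n \<in> ball z r - {z}" "X \<longlonglongrightarrow> z"
    define h where "h n = X n - z" for n
    have h: "h n \<noteq> 0" "norm (h n) \<le> r" for n
      using X(1) by (auto simp: h_def dist_norm norm_minus_commute less_imp_le)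
    have h0: "h \<longlonglongrightarrow> 0" unfolding h_def using X(2) by (simp add: LIM_zero)
    have int_z: "integrable lborel (\<lambda>y. of_real (f y) * exp (w * of_real y))" if "w \<in> ball z r" for w
    proof (rule integrable_bilateral_laplace[OF borel nonneg])
      have "\<bar>Re w - Re z\<bar> < r"
        using abs_Re_le_cmod[of "w - z"] that by (auto simp: dist_norm norm_minus_commute)
      then show "integrable lborel (\<lambda>y. f y * exp (Re w * y))"
        using r by (intro int) linarith+
    qed
    have quot: "(bilateral_laplace f (X n) - bilateral_laplace f z) / (X n - z)
        = (\<integral>y. of_real (f y) * exp (z * of_real y) * ((exp (h n * of_real y) - 1) / h n) \<partial>lborel)" for n
    proof -
      have "bilateral_laplace f (X n) - bilateral_laplace f z
          = (\<integral>y. of_real (f y) * exp (X n * of_real y) - of_real (f y) * exp (z * of_real y) \<partial>lborel)"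
        unfolding bilateral_laplace_def using X(1) r(1)
        by (intro Bochner_Integration.integral_diff [symmetric] int_z) auto
      then have "(bilateral_laplace f (X n) - bilateral_laplace f z) / h n
          = (\<integral>y. (of_real (f y) * exp (X n * of_real y) - of_real (f y) * exp (z * of_real y)) / h n \<partial>lborel)"
        by simp
      also have "\<dots> = (\<integral>y. of_real (f y) * exp (z * of_real y) * ((exp (h n * of_real y) - 1) / h n) \<partial>lborel)"
      proof (rule Bochner_Integration.integral_cong)
        fix y
        have "exp (X n * of_real y) = exp (z * of_real y) * exp (h n * of_real y)"
          by (simp add: h_def algebra_simps flip: exp_add)
        then show "(of_real (f y) * exp (X n * of_real y) - of_real (f y) * exp (z * of_real y)) / h n
            = of_real (f y) * exp (z * of_real y) * ((exp (h n * of_real y) - 1) / h n)"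
          by (simp add: algebra_simps diff_divide_distrib)
      qed simp
      finally show ?thesis by (simp add: h_def)
    qed
    have "(\<lambda>n. \<integral>y. of_real (f y) * exp (z * of_real y) * ((exp (h n * of_real y) - 1) / h n) \<partial>lborel) \<longlonglongrightarrow> ?L"
    proof (rule integral_dominated_convergence
        [where w = "\<lambda>y. (f y * exp ((Re z + 2 * r) * y) + f y * exp ((Re z - 2 * r) * y)) / r"])
      show "integrable lborel (\<lambda>y. (f y * exp ((Re z + 2 * r) * y) + f y * exp ((Re z - 2 * r) * y)) / r)"
        using r by (intro integrable_divide Bochner_Integration.integrable_add int) auto
      show "AE y in lborel. (\<lambda>n. of_real (f y) * exp (z * of_real y) * ((exp (h n * of_real y) - 1) / h n))
          \<longlonglongrightarrow> of_real (f y) * exp (z * of_real y) * of_real y"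
      proof (intro AE_I2 tendsto_mult tendsto_const)
        fix y :: real
        have "((\<lambda>x. exp (x * of_real y)) has_field_derivative of_real y) (at (0 :: complex))"
          by (auto intro!: derivative_eq_intros)
        then have "((\<lambda>x. (exp (x * of_real y) - 1) / x) \<longlongrightarrow> complex_of_real y) (at 0)"
          by (simp add: has_field_derivative_iff)
        then show "(\<lambda>n. (exp (h n * of_real y) - 1) / h n) \<longlonglongrightarrow> complex_of_real y"
          by (rule filterlim_compose) (use h h0 in \<open>auto simp: filterlim_at\<close>)
      qed
      show "AE y in lborel. norm (of_real (f y) * exp (z * of_real y) * ((exp (h n * of_real y) - 1) / h n))
          \<le> (f y * exp ((Re z + 2 * r) * y) + f y * exp ((Re z - 2 * r) * y)) / r" for n
      proof (rule AE_I2)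
        fix y
        have "norm (of_real (f y) * exp (z * of_real y) * ((exp (h n * of_real y) - 1) / h n))
            = f y * exp (Re z * y) * norm ((exp (h n * of_real y) - 1) / h n)"
          using nonneg[of y] by (simp only: norm_mult norm_exp_eq_Re) simp
        also have "\<dots> \<le> f y * exp (Re z * y) * ((exp (2 * r * y) + exp (- (2 * r * y))) / r)"
          using nonneg by (intro mult_left_mono norm_exp_diff_quotient_le r h) auto
        also have "\<dots> = (f y * (exp (Re z * y) * exp (2 * r * y)) + f y * (exp (Re z * y) * exp (- (2 * r * y)))) / r"
          by (simp add: algebra_simps)
        also have "\<dots> = (f y * exp ((Re z + 2 * r) * y) + f y * exp ((Re z - 2 * r) * y)) / r"
          by (simp add: algebra_simps flip: exp_add)
        finally show "norm (of_real (f y) * exp (z * of_real y) * ((exp (h n * of_real y) - 1) / h n))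
          \<le> (f y * exp ((Re z + 2 * r) * y) + f y * exp ((Re z - 2 * r) * y)) / r" .
      qed
    qed measurable
    then show "((\<lambda>w. (bilateral_laplace f w - bilateral_laplace f z) / (w - z)) \<circ> X) \<longlonglongrightarrow> ?L"
      by (simp add: o_def quot)
  qed
  then have "((\<lambda>w. (bilateral_laplace f w - bilateral_laplace f z) / (w - z)) \<longlongrightarrow> ?L) (at z)"
    using r by (simp add: at_within_open[of z "ball z r"])
  then have "(bilateral_laplace f has_field_derivative ?L) (at z)"
    by (simp add: has_field_derivative_iff)
  then show "\<exists>f'. (bilateral_laplace f has_field_derivative f') (at z within {z. u < Re z \<and> Re z < v})"
    using has_field_derivative_at_within by blast
qed

lemma integrable_inverse_1_plus_square_lborel: "integrable lborel (\<lambda>t::real. inverse (1 + t\<^sup>2))"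
  using integrable_inverse_1_plus_square by (simp add: set_integrable_def)

locale meromorphic_laplace =
  fixes F :: "complex \<Rightarrow> complex" and s1 s2 :: real and f :: "real \<Rightarrow> real"
  assumes mero: "F nicely_meromorphic_on UNIV"
    and nonneg: "\<And>y. 0 \<le> f y"
    and int_f: "integrable lborel f" and int_pos: "(\<integral>y. f y \<partial>lborel) > 0"
    and s12: "s1 < s2"
    and int: "\<And>s. s1 < s \<Longrightarrow> s < s2 \<Longrightarrow> integrable lborel (\<lambda>y. f y * exp (s * y))"
    and F_eq: "\<And>s. s1 < s \<Longrightarrow> s < s2 \<Longrightarrow> of_real (\<integral>y. f y * exp (s * y) \<partial>lborel) = F (of_real s)"
begin

lemma borel_f [measurable]: "f \<in> borel_measurable borel"
  using int_f by (simp add: borel_measurable_integrable)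

text \<open>The weight at a point between 0 and s is controlled by the weights at the two ends;
  integrability passes from the ends to everything between.\<close>

lemma exp_convex_le: "exp (\<theta> * s * y) \<le> 1 + exp (s * y)" if "0 \<le> \<theta>" "\<theta> \<le> 1" for \<theta> s y :: real
proof -
  have "\<theta> * s * y \<le> max 0 (s * y)"
    unfolding mult.assoc using that mult_left_le_one_le[of "s * y" \<theta>] mult_nonneg_nonpos[of \<theta> "s * y"] by linarith
  then have "exp (\<theta> * s * y) \<le> exp (max 0 (s * y))" by simp
  also have "\<dots> \<le> 1 + exp (s * y)" by (auto simp: max_def)
  finally show ?thesis .
qed

lemma integrable_scaled:
  assumes "s1 < s" "s < s2" "0 \<le> \<theta>" "\<theta> \<le> 1"
  shows "integrable lborel (\<lambda>y. f y * exp (\<theta> * s * y))"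
    and "(\<integral>y. f y * exp (\<theta> * s * y) \<partial>lborel) \<le> (\<integral>y. f y + f y * exp (s * y) \<partial>lborel)"
proof -
  have le: "f y * exp (\<theta> * s * y) \<le> f y + f y * exp (s * y)" for y
    using mult_left_mono[OF exp_convex_le[OF assms(3,4), of s y] nonneg[of y]] by (simp add: algebra_simps)
  have int': "integrable lborel (\<lambda>y. f y + f y * exp (s * y))"
    using assms by (intro Bochner_Integration.integrable_add int_f int)
  show i: "integrable lborel (\<lambda>y. f y * exp (\<theta> * s * y))"
    by (rule Bochner_Integration.integrable_bound[OF int'])
       (use le nonneg in \<open>auto intro!: AE_I2 simp: abs_mult add_nonneg_nonneg\<close>)
  show "(\<integral>y. f y * exp (\<theta> * s * y) \<partial>lborel) \<le> (\<integral>y. f y + f y * exp (s * y) \<partial>lborel)"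
    by (intro integral_mono i int' le)
qed

text \<open>A point outside the given interval lies between 0 and the midpoint \<open>m\<close>,
  hence is a multiple \<theta> m with \<theta> between 0 and 1.\<close>

lemma integrable_strip:
  assumes "min 0 s1 < s" "s < max 0 s2"
  shows "integrable lborel (\<lambda>y. f y * exp (s * y))"
proof -
  have "\<exists>s'. s1 < s' \<and> s' < s2 \<and> (\<exists>\<theta>\<ge>0. \<theta> \<le> 1 \<and> s = \<theta> * s')"
  proof (cases "s1 < s \<and> s < s2")
    case True
    then show ?thesis by (intro exI[of _ s] conjI exI[of _ 1]) auto
  next
    case False
    define m where "m = (s1 + s2) / 2"
    have m: "s1 < m" "m < s2" using s12 by (auto simp: m_def)
    consider "0 < s" "s \<le> s1" | "s < 0" "s2 \<le> s" | "s = 0" using False assms s12 by linarith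
    then have "\<exists>\<theta>\<ge>0. \<theta> \<le> 1 \<and> s = \<theta> * m"
    proof cases
      case 1 then show ?thesis using m by (intro exI[of _ "s / m"]) auto
    next
      case 2 then show ?thesis using m by (intro exI[of _ "s / m"]) (auto simp: divide_simps)
    qed (auto intro!: exI[of _ 0])
    then show ?thesis using m by blast
  qed
  then show ?thesis using integrable_scaled(1) by blast
qed

text \<open>A vanishing transform would force f = 0 almost everywhere. Positivity is what shows that
  the given interval contains no pole of F.\<close>

lemma laplace_pos:
  assumes "s1 < s" "s < s2"
  shows "(\<integral>y. f y * exp (s * y) \<partial>lborel) > 0"
proof (rule ccontr)
  assume "\<not> ?thesis"
  moreover have "(\<integral>y. f y * exp (s * y) \<partial>lborel) \<ge> 0"
    using nonneg by (intro Bochner_Integration.integral_nonneg) auto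
  ultimately have "(\<integral>y. f y * exp (s * y) \<partial>lborel) = 0" by simp
  then have "AE y in lborel. f y * exp (s * y) = 0"
    using integral_nonneg_eq_0_iff_AE[OF int[OF assms]] nonneg by simp
  then have "(\<integral>y. f y \<partial>lborel) = (\<integral>y. 0 \<partial>(lborel :: real measure))"
    by (intro integral_cong_AE) auto
  then show False using int_pos by simp
qed

text \<open>The identity theorem on the strip without the poles, which stays connected because they
  are sparse. The poles are excluded afterwards: near such a point F agrees with a holomorphic
  function.\<close>

lemma F_eq_laplace:
  assumes "min 0 s1 < Re z" "Re z < max 0 s2"
  shows "\<not> is_pole F z \<and> F z = bilateral_laplace f z"
proof -
  define S where "S = {z. min 0 s1 < Re z \<and> Re z < max 0 s2}"
  let ?P = "{z. is_pole F z}"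
  have mero': "F meromorphic_on UNIV" using mero by (simp add: nicely_meromorphic_on_def)
  have iso: "isolated_singularity_at F w" for w
    by (rule meromorphic_on_isolated_singularity[OF meromorphic_on_subset[OF mero']]) simp
  have S_alt: "S = {z. min 0 s1 < Re z} \<inter> {z. Re z < max 0 s2}" by (auto simp: S_def)
  have S: "open S" "convex S"
    unfolding S_alt by (intro open_Int open_halfspace_Re_gt open_halfspace_Re_lt
        convex_Int convex_halfspace_Re_gt convex_halfspace_Re_lt)+
  have sparse: "?P sparse_in S"
    using S(1) not_islimpt_poles[OF iso] by (subst sparse_in_open) auto
  have G: "bilateral_laplace f holomorphic_on S"
    unfolding S_def by (intro holomorphic_bilateral_laplace borel_f nonneg integrable_strip)
  have eq: "F w = bilateral_laplace f w" if "w \<in> S - ?P" for w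
  proof -
    define \<xi> where "\<xi> = complex_of_real ((s1 + s2) / 2)"
    define U where "U = complex_of_real ` {s1<..<s2}"
    have "F w - bilateral_laplace f w = 0"
    proof (rule analytic_continuation[of "\<lambda>w. F w - bilateral_laplace f w"])
      show "(\<lambda>w. F w - bilateral_laplace f w) holomorphic_on S - ?P"
      proof (intro holomorphic_intros holomorphic_on_subset[OF G])
        show "F holomorphic_on S - ?P"
        proof (rule analytic_imp_holomorphic)
          show "F analytic_on S - ?P"
            by (subst analytic_on_analytic_at) (use nicely_meromorphic_on_imp_analytic_at[OF mero] in blast)
        qed
      qed auto
      show "open (S - ?P)" using sparse S(1) by (intro open_diff_sparse_pts)
      show "connected (S - ?P)" using sparse S by (intro sparse_imp_connected convex_connected) auto
      show U: "U \<subseteq> S - ?P"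
      proof
        fix x assume "x \<in> U"
        then obtain s where s: "s1 < s" "s < s2" "x = of_real s" by (auto simp: U_def)
        \<comment> \<open>A nicely meromorphic function is 0 at its poles, so a non-zero value rules
          out a pole.\<close>
        have "F x \<noteq> 0" using laplace_pos[OF s(1,2)] F_eq[OF s(1,2)] s(3) by auto
        then have "\<not> is_pole F x" using is_pole_zero_at_nicely_mero[OF mero] by auto
        then show "x \<in> S - ?P" using s by (auto simp: S_def)
      qed
      have "\<xi> \<in> U" unfolding \<xi>_def U_def by (rule imageI) (use s12 in simp)
      then show "\<xi> \<in> S - ?P" using U by blast
      have "((s1 + s2) / 2) islimpt {s1<..<s2}"
        using s12 by (intro interior_limit_point) auto
      then show "\<xi> islimpt U"
        unfolding \<xi>_def U_def by (rule islimpt_isCont_image) (simp_all del: of_real_add of_real_divide add: eventually_at_filter)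
      show "F x - bilateral_laplace f x = 0" if "x \<in> U" for x
        using that F_eq by (auto simp: U_def bilateral_laplace_of_real)
      show "w \<in> S - ?P" by fact
    qed
    then show ?thesis by simp
  qed
  have "\<not> is_pole F w" if "w \<in> S" for w
  proof -
    have "eventually (\<lambda>x. x \<in> S) (at w)" using S(1) that by (intro eventually_at_in_open')
    \<comment> \<open>Poles are isolated, so the equality holds in a punctured neighbourhood of w,
      whether or not w is a pole itself.\<close>
    then have "eventually (\<lambda>x. F x = bilateral_laplace f x) (at w)"
      using eventually_not_pole[OF iso[of w]] by eventually_elim (use eq in auto)
    then have "is_pole F w \<longleftrightarrow> is_pole (bilateral_laplace f) w"
      by (intro is_pole_cong refl)
    moreover have "\<not> is_pole (bilateral_laplace f) w"
      using G S(1) that by (intro analytic_at_imp_no_pole) (auto simp: analytic_at)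
    ultimately show ?thesis by simp
  qed
  then show ?thesis using eq[of z] assms by (auto simp: S_def)
qed

text \<open>
  The origin may lie on the boundary of the strip, where \<open>F\<close> and the transform are not compared
  directly; there the transform is bounded along the real axis, which excludes a pole.
\<close>

lemma no_pole_0: "\<not> is_pole F 0"
proof
  assume pole: "is_pole F 0"
  obtain s where s: "s1 < s" "s < s2" "s \<noteq> 0"
  proof -
    obtain u where u: "s1 < u" "u < s2" using dense[OF s12] by blast
    obtain v where v: "u < v" "v < s2" using dense[OF u(2)] by blast
    show thesis using that[of u] that[of v] u v by (cases "u = 0") auto
  qed
  define B where "B = (\<integral>y. f y + f y * exp (s * y) \<partial>lborel)"
  have "filterlim (\<lambda>n. complex_of_real (inverse (real (Suc n)) * s)) (at 0) sequentially"
  proof -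
    have "(\<lambda>n. complex_of_real (inverse (real (Suc n)) * s)) \<longlonglongrightarrow> of_real (0 * s)"
      by (intro tendsto_of_real tendsto_mult LIMSEQ_inverse_real_of_nat tendsto_const)
    then show ?thesis
      by (intro filterlim_atI always_eventually allI) (use s(3) in \<open>simp_all del: of_nat_Suc\<close>)
  qed
  with pole have "filterlim (\<lambda>n. F (complex_of_real (inverse (real (Suc n)) * s))) at_infinity sequentially"
    unfolding is_pole_def by (rule filterlim_compose)
  then have "eventually (\<lambda>n. norm (F (complex_of_real (inverse (real (Suc n)) * s))) \<ge> \<bar>B\<bar> + 1) sequentially"
    by (auto simp: filterlim_at_infinity[OF order_refl])
  then obtain n where n: "norm (F (complex_of_real (inverse (real (Suc n)) * s))) \<ge> \<bar>B\<bar> + 1"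
    by (auto simp: eventually_sequentially)
  define \<theta> where "\<theta> = inverse (real (Suc n))"
  have \<theta>: "0 < \<theta>" "\<theta> \<le> 1" by (auto simp: \<theta>_def field_simps)
  have "min 0 s1 < \<theta> * s \<and> \<theta> * s < max 0 s2"
  proof (cases "s > 0")
    case True
    then have "0 < \<theta> * s" "\<theta> * s \<le> s" using \<theta> by (auto simp: mult_le_cancel_right1)
    then show ?thesis using s by auto
  next
    case False
    then have "\<theta> * s < 0" "s \<le> \<theta> * s" using \<theta> s(3) by (auto simp: mult_le_cancel_right1 mult_less_0_iff)
    then show ?thesis using s by auto
  qed
  then have "F (of_real (\<theta> * s)) = bilateral_laplace f (of_real (\<theta> * s))"
    by (intro F_eq_laplace[THEN conjunct2]) auto
  also have "norm \<dots> \<le> (\<integral>y. f y * exp (\<theta> * s * y) \<partial>lborel)"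
    using norm_bilateral_laplace_le[of f "of_real (\<theta> * s)"] nonneg by simp
  also have "\<dots> \<le> B" unfolding B_def using \<theta> s by (intro integrable_scaled) auto
  finally show False using n by (simp add: \<theta>_def)
qed

end

locale meromorphic_laplace_decay = meromorphic_laplace F s1 s2 f + vertical_decay F \<delta>
  for F s1 s2 f \<delta> +
  assumes cont: "continuous_on UNIV f"
begin

text \<open>On the line Re s = c the function F is the Fourier transform of f(y) exp (c y).
  Inversion recovers this tilted density, and undoing the tilt turns the kernel into exp (- s
  y).\<close>

lemma density_expansion:
  obtains c where "\<And>\<sigma>. \<sigma> > 0 \<Longrightarrow> \<sigma> > c \<Longrightarrow> \<not> is_pole F (of_real \<sigma>) \<Longrightarrow>
    \<exists>K. \<forall>y. norm (of_real (f y) - (\<Sum>\<rho> | 0 < \<rho> \<and> \<rho> \<le> \<sigma> \<and> is_pole F (of_real \<rho>). pole_term F \<rho> y)) \<le> K * exp (- \<sigma> * y)"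
proof -
  obtain c where c: "s1 < c" "c < s2" using s12 dense by blast
  have strip: "min 0 s1 < c" "c < max 0 s2" using c by auto
  have cpole: "\<not> is_pole F (of_real c)" using F_eq_laplace[of "of_real c"] strip by simp
  define g where "g y = f y * exp (c * y)" for y
  define \<phi> where "\<phi> t = F (Complex c t)" for t
  obtain B where B: "B \<ge> 0" "\<And>t. norm (F (Complex c t)) \<le> B * inverse (1 + t\<^sup>2)"
    using vertical_bound[OF cpole] by metis
  have cont_\<phi>: "continuous_on UNIV \<phi>"
    unfolding \<phi>_def by (rule continuous_vertical[OF cpole])
  have int_\<phi>: "integrable lborel \<phi>"
  proof (rule Bochner_Integration.integrable_bound)
    show "integrable lborel (\<lambda>t. B * inverse (1 + t\<^sup>2))"
      by (intro integrable_mult_right integrable_inverse_1_plus_square_lborel)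
    show "\<phi> \<in> borel_measurable lborel"
      using borel_measurable_continuous_onI[OF cont_\<phi>] by simp
    show "AE t in lborel. norm (\<phi> t) \<le> norm (B * inverse (1 + t\<^sup>2))"
      using B order.trans[OF B(2) abs_ge_self] by (intro AE_I2) (simp add: \<phi>_def)
  qed
  have \<phi>_eq: "\<phi> t = (\<integral>y. of_real (g y) * iexp (t * y) \<partial>lborel)" for t
  proof -
    have "\<phi> t = bilateral_laplace f (Complex c t)"
      unfolding \<phi>_def using strip by (intro F_eq_laplace[THEN conjunct2]) auto
    also have "\<dots> = (\<integral>y. of_real (g y) * iexp (t * y) \<partial>lborel)"
      unfolding bilateral_laplace_def
    proof (rule Bochner_Integration.integral_cong)
      fix y
      have "exp (Complex c t * of_real y) = of_real (exp (c * y)) * iexp (t * y)"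
        by (simp add: Complex_eq algebra_simps flip: exp_add exp_of_real)
      then show "of_real (f y) * exp (Complex c t * of_real y) = of_real (g y) * iexp (t * y)"
        by (simp add: g_def)
    qed simp
    finally show ?thesis .
  qed
  interpret fourier_pair g \<phi>
  proof
    show "continuous_on UNIV g" unfolding g_def by (intro continuous_intros cont)
    show "integrable lborel g" unfolding g_def by (rule int[OF c])
    show "(\<integral>y. g y \<partial>lborel) > 0" unfolding g_def by (rule laplace_pos[OF c])
  qed (use nonneg int_\<phi> \<phi>_eq in \<open>auto simp: g_def\<close>)
  note inv = fourier_inversion_LIMSEQ[OF cont_\<phi>]
  have inv': "(\<lambda>n. integral {-real n..real n} (\<lambda>t. F (Complex c t) * exp (- (Complex c t * of_real y))) / of_real (2 * pi))
      \<longlonglongrightarrow> of_real (f y)" for y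
  proof -
    have "exp (- (Complex c t * of_real y)) = of_real (exp (- c * y)) * iexp (- (t * y))" for t
      by (simp add: Complex_eq algebra_simps flip: exp_add exp_of_real)
    then have "integral {-real n..real n} (\<lambda>t. F (Complex c t) * exp (- (Complex c t * of_real y)))
        = of_real (exp (- c * y)) * integral {-real n..real n} (\<lambda>t. \<phi> t * iexp (- (t * y)))" for n
      by (simp only: \<phi>_def mult.left_commute[of _ "of_real (exp (- c * y))"] integral_mult_right)
    moreover have "of_real (exp (- c * y)) * of_real (g y) = complex_of_real (f y)"
      by (simp add: g_def flip: exp_add of_real_mult)
    ultimately show ?thesis
      using tendsto_mult[OF tendsto_const inv, of "of_real (exp (- c * y))" y] by simp
  qed
  \<comment> \<open>The number c may have either sign. Excluding the whole closed segment between 0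
    and c, the origin included, makes the poles from c on the same as those in the open right
    half-line.\<close>
  have no_pole: "\<not> is_pole F (of_real \<rho>)" if "min 0 c \<le> \<rho>" "\<rho> \<le> max 0 c" for \<rho>
  proof (cases "\<rho> = 0")
    case True then show ?thesis using no_pole_0 by simp
  next
    case False
    then have "min 0 s1 < \<rho>" "\<rho> < max 0 s2" using that strip c by (auto simp: min_def max_def split: if_splits)
    then show ?thesis using F_eq_laplace[of "of_real \<rho>"] by simp
  qed
  show ?thesis
  proof (rule that[of c])
    fix \<sigma> assume \<sigma>: "\<sigma> > 0" "\<sigma> > c" "\<not> is_pole F (of_real \<sigma>)"
    have set_eq: "{\<rho>. c \<le> \<rho> \<and> \<rho> \<le> \<sigma> \<and> is_pole F (of_real \<rho>)} = {\<rho>. 0 < \<rho> \<and> \<rho> \<le> \<sigma> \<and> is_pole F (of_real \<rho>)}"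
      using no_pole by (auto simp: min_def max_def not_less split: if_splits) (smt (verit))+
    obtain K where "\<And>y h. (\<lambda>n. integral {-real n..real n} (\<lambda>t. F (Complex c t) * exp (- (Complex c t * of_real y)))
        / of_real (2 * pi)) \<longlonglongrightarrow> h \<Longrightarrow>
      norm (h - (\<Sum>\<rho> | c \<le> \<rho> \<and> \<rho> \<le> \<sigma> \<and> is_pole F (of_real \<rho>). pole_term F \<rho> y)) \<le> K * exp (- \<sigma> * y)"
      by (rule contour_shift[OF \<sigma>(2) cpole \<sigma>(3)]) (rule that)
    from this[OF inv'] show "\<exists>K. \<forall>y. norm (of_real (f y) - (\<Sum>\<rho> | 0 < \<rho> \<and> \<rho> \<le> \<sigma> \<and> is_pole F (of_real \<rho>). pole_term F \<rho> y)) \<le> K * exp (- \<sigma> * y)"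
      unfolding set_eq by blast
  qed
qed

end

section \<open>Asymptotic expansion\<close>

text \<open>The coefficient at the pole order is the lowest one of the Laurent series; its
  non-vanishing makes the leading asymptotic term genuine.\<close>

lemma sing_coeff_pole_order_neq_0:
  assumes "F meromorphic_on {z}" "is_pole F z"
  shows "pole_order F z \<ge> 1" "sing_coeff F (pole_order F z) z \<noteq> 0"
proof -
  have L: "(\<lambda>w. F (z + w)) has_laurent_expansion laurent_expansion F z"
    by (rule meromorphic_on_imp_has_laurent_expansion[OF assms(1)]) simp
  have neg: "fls_subdegree (laurent_expansion F z) < 0"
    using is_pole_imp_neg_fls_subdegree[OF L] assms(2) by simp
  then have nz: "laurent_expansion F z \<noteq> 0" by auto
  have zo: "zorder F z = fls_subdegree (laurent_expansion F z)"
    by (rule has_laurent_expansion_zorder[OF L nz])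
  show "pole_order F z \<ge> 1" using neg by (simp add: pole_order_def zo)
  show "sing_coeff F (pole_order F z) z \<noteq> 0"
    using neg nz by (simp add: sing_coeff_def pole_order_def zo)
qed

lemma residue_eq_sing_coeff:
  assumes "F meromorphic_on {z}"
  shows "residue F z = sing_coeff F 1 z"
proof -
  have "(\<lambda>w. F (z + w)) has_laurent_expansion laurent_expansion F z"
    by (rule meromorphic_on_imp_has_laurent_expansion[OF assms]) simp
  from has_laurent_expansion_residue[OF this] show ?thesis by (simp add: sing_coeff_def)
qed

section \<open>Comparison of decay scales\<close>

lemma exp_power_bigo:
  fixes \<rho> \<sigma> :: real
  assumes "\<sigma> < \<rho>"
  shows "(\<lambda>y. exp (- \<rho> * y) * y ^ l) \<in> O[at_top](\<lambda>y. exp (- \<sigma> * y))"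
proof -
  obtain A where A: "A \<ge> 0" "\<And>t. t \<ge> 0 \<Longrightarrow> (0 + t) ^ l \<le> A * exp ((\<rho> - \<sigma>) * t)"
    using power_le_exp_bound[of "\<rho> - \<sigma>"] assms by (metis diff_gt_0_iff_gt)
  have "norm (exp (- \<rho> * y) * y ^ l) \<le> A * norm (exp (- \<sigma> * y))" if "y \<ge> 0" for y
  proof -
    have "exp (- \<rho> * y) * y ^ l \<le> exp (- \<rho> * y) * (A * exp ((\<rho> - \<sigma>) * y))"
      using A(2)[OF that] by (intro mult_left_mono) auto
    also have "\<dots> = A * exp (- \<rho> * y + (\<rho> - \<sigma>) * y)" by (simp only: exp_add mult_ac)
    also have "- \<rho> * y + (\<rho> - \<sigma>) * y = - \<sigma> * y" by (simp add: algebra_simps)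
    finally show ?thesis using that by (simp add: abs_mult)
  qed
  then show ?thesis
    by (intro bigoI[where c = A]) (auto intro: eventually_mono[OF eventually_ge_at_top[of 0]])
qed

lemma of_real_bigo:
  fixes f g :: "real \<Rightarrow> real"
  assumes "f \<in> O[F](g)"
  shows "(\<lambda>x. complex_of_real (f x)) \<in> O[F](\<lambda>x. complex_of_real (g x))"
  using assms by (simp add: bigo_def)

lemma of_real_smallo:
  fixes f g :: "real \<Rightarrow> real"
  assumes "f \<in> o[F](g)"
  shows "(\<lambda>x. complex_of_real (f x)) \<in> o[F](\<lambda>x. complex_of_real (g x))"
  using assms by (simp add: smallo_def)

lemma pole_term_bigo:
  assumes "\<sigma> < \<rho>"
  shows "pole_term F \<rho> \<in> O[at_top](\<lambda>y. complex_of_real (exp (- \<sigma> * y)))"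
proof -
  have "(\<lambda>y. c * complex_of_real (exp (- \<rho> * y) * y ^ l)) \<in> O[at_top](\<lambda>y. complex_of_real (exp (- \<sigma> * y)))" for c l
    using of_real_bigo[OF exp_power_bigo[OF assms, of l]] by (cases "c = 0") simp_all
  then have "(\<lambda>y. pole_term F \<rho> y) \<in> O[at_top](\<lambda>y. complex_of_real (exp (- \<sigma> * y)))"
    unfolding pole_term_def by (intro big_sum_in_bigo)
  then show ?thesis .
qed

lemma exp_bigo_exp:
  fixes \<sigma> \<rho> :: real
  assumes "\<sigma> \<le> \<rho>"
  shows "(\<lambda>y. exp (- \<rho> * y)) \<in> O[at_top](\<lambda>y. exp (- \<sigma> * y))"
  using assms
  by (intro bigoI[where c = 1] eventually_mono[OF eventually_ge_at_top[of 0]]) (auto intro: mult_right_mono)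

context vertical_decay
begin

text \<open>Removes the conditions on \<sigma>. The expansion is applied at a larger
  \<open>\<sigma>'\<close> beyond c that is not a pole; every surplus term has its pole strictly
  beyond \<sigma>, so it is O(exp (- \<sigma> y)) despite its powers of y.\<close>

lemma expansion_bigo:
  assumes exp: "\<And>\<sigma>. \<sigma> > 0 \<Longrightarrow> \<sigma> > c \<Longrightarrow> \<not> is_pole F (of_real \<sigma>) \<Longrightarrow>
      \<exists>K. \<forall>y. norm (of_real (f y) - (\<Sum>\<rho> | 0 < \<rho> \<and> \<rho> \<le> \<sigma> \<and> is_pole F (of_real \<rho>). pole_term F \<rho> y)) \<le> K * exp (- \<sigma> * y)"
    and "\<sigma> > 0"
  shows "(\<lambda>y. of_real (f y) - (\<Sum>\<rho> | 0 < \<rho> \<and> \<rho> \<le> \<sigma> \<and> is_pole F (of_real \<rho>). pole_term F \<rho> y))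
    \<in> O[at_top](\<lambda>y. complex_of_real (exp (- \<sigma> * y)))"
proof -
  define P where "P s = {\<rho>. 0 < \<rho> \<and> \<rho> \<le> s \<and> is_pole F (of_real \<rho>)}" for s
  have fin: "finite (P s)" for s
    by (rule finite_subset[OF _ finite_real_poles[of 0 s]]) (auto simp: P_def)
  define m where "m = max \<sigma> c"
  \<comment> \<open>An open interval is infinite and holds finitely many poles, so a pole-free
    abscissa exists.\<close>
  have "infinite ({m<..<m + 1} - P (m + 1))"
    using fin by (simp add: Diff_infinite_finite)
  then obtain \<sigma>' where \<sigma>': "\<sigma>' \<in> {m<..<m + 1} - P (m + 1)" by (metis ex_in_conv finite.emptyI)
  then have s: "\<sigma>' > \<sigma>" "\<sigma>' > c" "\<sigma>' > 0" "\<not> is_pole F (of_real \<sigma>')"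
    using \<open>\<sigma> > 0\<close> by (auto simp: P_def m_def)
  obtain K where K: "\<And>y. norm (of_real (f y) - (\<Sum>\<rho>\<in>P \<sigma>'. pole_term F \<rho> y)) \<le> K * exp (- \<sigma>' * y)"
    using exp[OF s(3,2,4)] unfolding P_def by blast
  have "(\<lambda>y. of_real (f y) - (\<Sum>\<rho>\<in>P \<sigma>'. pole_term F \<rho> y)) \<in> O[at_top](\<lambda>y. complex_of_real (exp (- \<sigma>' * y)))"
    using K by (intro bigoI[where c = K]) auto
  also have "(\<lambda>y. complex_of_real (exp (- \<sigma>' * y))) \<in> O[at_top](\<lambda>y. complex_of_real (exp (- \<sigma> * y)))"
    using s by (intro of_real_bigo exp_bigo_exp) auto
  finally have 1: "(\<lambda>y. of_real (f y) - (\<Sum>\<rho>\<in>P \<sigma>'. pole_term F \<rho> y)) \<in> O[at_top](\<lambda>y. complex_of_real (exp (- \<sigma> * y)))" .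
  have "(\<lambda>y. \<Sum>\<rho>\<in>P \<sigma>' - P \<sigma>. pole_term F \<rho> y) \<in> O[at_top](\<lambda>y. complex_of_real (exp (- \<sigma> * y)))"
    by (intro big_sum_in_bigo pole_term_bigo) (auto simp: P_def)
  from sum_in_bigo(1)[OF 1 this]
  have "(\<lambda>y. of_real (f y) - (\<Sum>\<rho>\<in>P \<sigma>'. pole_term F \<rho> y) + (\<Sum>\<rho>\<in>P \<sigma>' - P \<sigma>. pole_term F \<rho> y))
      \<in> O[at_top](\<lambda>y. complex_of_real (exp (- \<sigma> * y)))" .
  moreover have "(\<Sum>\<rho>\<in>P \<sigma>' - P \<sigma>. pole_term F \<rho> y) = (\<Sum>\<rho>\<in>P \<sigma>'. pole_term F \<rho> y) - (\<Sum>\<rho>\<in>P \<sigma>. pole_term F \<rho> y)" for y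
    using s by (intro sum_diff fin) (auto simp: P_def)
  ultimately show ?thesis by (simp add: P_def)
qed

text \<open>That the least positive pole is attained follows from finiteness of the poles below any
  given one; finiteness also leaves a gap to its right.\<close>

lemma isolated_least_pole:
  assumes "\<exists>x>0. is_pole F (of_real x)"
  defines "\<rho> \<equiv> (LEAST x::real. 0 < x \<and> is_pole F (of_real x))"
  obtains \<eta> where "\<rho> > 0" "is_pole F (of_real \<rho>)" "\<eta> > 0"
    "{x. 0 < x \<and> x \<le> \<rho> + \<eta> \<and> is_pole F (of_real x)} = {\<rho>}"
proof -
  define P where "P s = {x. 0 < x \<and> x \<le> s \<and> is_pole F (of_real x)}" for s
  have fin: "finite (P s)" for s
    by (rule finite_subset[OF _ finite_real_poles[of 0 s]]) (auto simp: P_def)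
  obtain x where x: "x > 0" "is_pole F (of_real x)" using assms by blast
  define m where "m = Min (P x)"
  have "m \<in> P x" unfolding m_def by (intro Min_in fin) (use x in \<open>auto simp: P_def\<close>)
  moreover have le: "m \<le> y" if "y > 0" "is_pole F (of_real y)" for y
  proof (cases "y \<le> x")
    case True
    then show ?thesis unfolding m_def using that by (intro Min_le fin) (auto simp: P_def)
  next
    case False
    then show ?thesis using \<open>m \<in> P x\<close> by (simp add: P_def)
  qed
  ultimately have "\<rho> = m" unfolding \<rho>_def by (intro Least_equality) (auto simp: P_def)
  then have \<rho>: "\<rho> > 0" "is_pole F (of_real \<rho>)" and least: "\<And>y. y > 0 \<Longrightarrow> is_pole F (of_real y) \<Longrightarrow> \<rho> \<le> y"
    using \<open>m \<in> P x\<close> le by (auto simp: P_def)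
  define Q where "Q = P (\<rho> + 1) - {\<rho>}"
  \<comment> \<open>Half the distance to the next pole, or to \<rho> + 1 if no pole comes
    earlier.\<close>
  define \<eta> where "\<eta> = (Min (insert (\<rho> + 1) Q) - \<rho>) / 2"
  have "finite Q" unfolding Q_def using fin by blast
  have "\<forall>q\<in>insert (\<rho> + 1) Q. \<rho> < q" using least by (force simp: Q_def P_def)
  then have "\<rho> < Min (insert (\<rho> + 1) Q)" using \<open>finite Q\<close> by (subst Min_gr_iff) auto
  then have \<eta>: "\<eta> > 0" by (simp add: \<eta>_def)
  have Min_le: "Min (insert (\<rho> + 1) Q) \<le> q" if "q \<in> insert (\<rho> + 1) Q" for q
    using \<open>finite Q\<close> that by (intro Min_le) auto
  have "y = \<rho>" if "0 < y" "y \<le> \<rho> + \<eta>" "is_pole F (of_real y)" for y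
  proof (rule ccontr)
    assume "y \<noteq> \<rho>"
    have "\<rho> + \<eta> < Min (insert (\<rho> + 1) Q)" using \<eta> by (simp add: \<eta>_def field_simps)
    moreover have "Min (insert (\<rho> + 1) Q) \<le> \<rho> + 1" by (rule Min_le) simp
    ultimately have "y \<in> Q" using that \<open>y \<noteq> \<rho>\<close> by (auto simp: Q_def P_def)
    then have "Min (insert (\<rho> + 1) Q) \<le> y" by (intro Min_le) simp
    then show False using that \<open>\<rho> + \<eta> < Min (insert (\<rho> + 1) Q)\<close> by linarith
  qed
  then have "{x. 0 < x \<and> x \<le> \<rho> + \<eta> \<and> is_pole F (of_real x)} = {\<rho>}"
    using \<rho> \<eta> by auto
  then show ?thesis using that \<rho> \<eta> by blast
qed

end

section \<open>The leading term at a pole\<close>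

lemma pole_term_factor:
  "pole_term F \<rho> y = of_real (exp (- \<rho> * y)) *
     (\<Sum>l<pole_order F (of_real \<rho>). (-1) ^ (l + 1) * sing_coeff F (l + 1) (of_real \<rho>) / fact l * of_real (y ^ l))"
  unfolding pole_term_def sum_distrib_left by (intro sum.cong refl) (simp add: mult_ac)

text \<open>Within the contribution of the pole the highest power of y wins, and the remainder is
  smaller by an exponential factor.\<close>

lemma pole_term_asymp_equiv:
  fixes f :: "real \<Rightarrow> complex"
  assumes mero: "F meromorphic_on {of_real \<rho>}" and pole: "is_pole F (of_real \<rho>)" and "\<eta> > 0"
    and f: "(\<lambda>y. f y - pole_term F \<rho> y) \<in> O[at_top](\<lambda>y. complex_of_real (exp (- (\<rho> + \<eta>) * y)))"
  defines "\<nu> \<equiv> pole_order F (of_real \<rho>)"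
  shows "f \<sim>[at_top] (\<lambda>y. (-1) ^ \<nu> * sing_coeff F \<nu> (of_real \<rho>) / fact (\<nu> - 1) * of_real (exp (- \<rho> * y) * y ^ (\<nu> - 1)))"
proof -
  define n where "n = \<nu> - 1"
  have \<nu>: "\<nu> = Suc n" "sing_coeff F \<nu> (of_real \<rho>) \<noteq> 0"
    using sing_coeff_pole_order_neq_0[OF mero pole] by (auto simp: n_def \<nu>_def)
  define g where "g y = exp (- \<rho> * y) * y ^ n" for y :: real
  define k where "k l = (-1) ^ (l + 1) * sing_coeff F (l + 1) (of_real \<rho>) / fact l" for l
  \<comment> \<open>The index shift l + 1 makes n = \<nu> - 1 correspond to the lowest Laurent
    coefficient, which is non-zero; this allows the later passage from little-o to an
    equivalence.\<close>
  have k: "k n \<noteq> 0" using \<nu> by (simp add: k_def)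
  have pt: "pole_term F \<rho> y = k n * of_real (g y) + (\<Sum>l<n. k l * of_real (exp (- \<rho> * y) * y ^ l))" for y
    unfolding pole_term_def \<nu>_def [symmetric] \<nu>(1) k_def g_def by simp
  have "(\<lambda>y. exp (- (\<rho> + \<eta>) * y)) \<in> o[at_top](g)"
  proof (rule smalloI_tendsto)
    \<comment> \<open>For y \<ge> 1 dividing by y^n only helps, so exp (- \<eta> y) bounds the
      quotient.\<close>
    have le: "eventually (\<lambda>y. exp (- \<eta> * y) \<ge> exp (- (\<rho> + \<eta>) * y) / g y) at_top"
      using eventually_ge_at_top[of 1]
    proof eventually_elim
      case (elim y)
      then have "1 \<le> y ^ n" by simp
      have "exp (- (\<rho> + \<eta>) * y) = exp (- \<eta> * y) * exp (- \<rho> * y)"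
        by (simp add: algebra_simps flip: exp_add)
      then have "exp (- (\<rho> + \<eta>) * y) / g y = exp (- \<eta> * y) / y ^ n"
        by (simp add: g_def)
      also have "\<dots> \<le> exp (- \<eta> * y) / 1"
        using \<open>1 \<le> y ^ n\<close> by (intro divide_left_mono) auto
      finally show ?case by simp
    qed
    have ge: "eventually (\<lambda>y. exp (- (\<rho> + \<eta>) * y) / g y \<ge> 0) at_top"
      using eventually_ge_at_top[of 1] by eventually_elim (auto simp: g_def)
    have lim: "((\<lambda>y. exp (- \<eta> * y)) \<longlongrightarrow> 0) at_top"
      using \<open>\<eta> > 0\<close> by real_asymp
    show "((\<lambda>y. exp (- (\<rho> + \<eta>) * y) / g y) \<longlongrightarrow> 0) at_top"
      by (rule tendsto_sandwich[OF ge le tendsto_const lim])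
    show "eventually (\<lambda>y. g y \<noteq> 0) at_top"
      using eventually_gt_at_top[of 0] by eventually_elim (auto simp: g_def)
  qed
  from landau_o.big_small_trans[OF f of_real_smallo[OF this]]
  have 1: "(\<lambda>y. f y - pole_term F \<rho> y) \<in> o[at_top](\<lambda>y. complex_of_real (g y))" .
  have "(\<lambda>y. k l * of_real (exp (- \<rho> * y) * y ^ l)) \<in> o[at_top](\<lambda>y. complex_of_real (g y))" if "l < n" for l
  proof -
    have "(\<lambda>y. exp (- \<rho> * y) * y ^ l) \<in> o[at_top](g)"
    proof (rule smalloI_tendsto)
      have "((\<lambda>y::real. inverse (y ^ (n - l))) \<longlongrightarrow> 0) at_top"
        using that by (intro tendsto_inverse_0_at_top filterlim_pow_at_top filterlim_ident) auto
      moreover have "eventually (\<lambda>y. inverse (y ^ (n - l)) = exp (- \<rho> * y) * y ^ l / g y) at_top"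
        using eventually_gt_at_top[of 0]
      proof eventually_elim
        case (elim y)
        have "y ^ n = y ^ l * y ^ (n - l)" using that by (simp flip: power_add)
        then show ?case using elim by (simp add: g_def field_simps)
      qed
      ultimately show "((\<lambda>y. exp (- \<rho> * y) * y ^ l / g y) \<longlongrightarrow> 0) at_top"
        by (rule Lim_transform_eventually)
      show "eventually (\<lambda>y. g y \<noteq> 0) at_top"
        using eventually_gt_at_top[of 0] by eventually_elim (auto simp: g_def)
    qed
    then show ?thesis
      by (cases "k l = 0") (auto dest: of_real_smallo)
  qed
  then have 2: "(\<lambda>y. \<Sum>l<n. k l * of_real (exp (- \<rho> * y) * y ^ l)) \<in> o[at_top](\<lambda>y. complex_of_real (g y))"
    by (intro big_sum_in_smallo) auto
  from sum_in_smallo(1)[OF 1 2]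
  have "(\<lambda>y. f y - k n * of_real (g y)) \<in> o[at_top](\<lambda>y. complex_of_real (g y))"
    by (simp add: pt)
  then have "(\<lambda>y. f y - k n * of_real (g y)) \<in> o[at_top](\<lambda>y. k n * of_real (g y))"
    using k by simp
  then have "f \<sim>[at_top] (\<lambda>y. k n * of_real (g y))"
    by (simp add: asymp_equiv_altdef)
  then show ?thesis by (simp add: k_def g_def \<nu>)
qed

text \<open>The substitution y = log x. The Jacobian 1 / x accounts for the extra -1 in the exponent
  of x.\<close>

lemma bigo_exp_to_powr:
  fixes h :: "real \<Rightarrow> complex"
  assumes "h \<in> O[at_top](\<lambda>y. complex_of_real (exp (- s * y)))"
    and "\<And>x. x > 0 \<Longrightarrow> g x = of_real (1 / x) * h (ln x)"
  shows "g \<in> O[at_top](\<lambda>x. complex_of_real (x powr (- s - 1)))"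
proof -
  have "(\<lambda>x. h (ln x)) \<in> O[at_top](\<lambda>x. complex_of_real (exp (- s * ln x)))"
    by (rule landau_o.big.compose[OF assms(1) ln_at_top])
  then have "(\<lambda>x. of_real (1 / x) * h (ln x)) \<in> O[at_top](\<lambda>x. of_real (1 / x) * complex_of_real (exp (- s * ln x)))"
    by (intro landau_o.big.mult) auto
  also have "?this \<longleftrightarrow> ?thesis"
  proof (rule landau_o.big.cong_ex)
    show "eventually (\<lambda>x. of_real (1 / x) * h (ln x) = g x) at_top"
      using eventually_gt_at_top[of 0] by eventually_elim (simp add: assms(2))
    show "eventually (\<lambda>x. of_real (1 / x) * complex_of_real (exp (- s * ln x)) = complex_of_real (x powr (- s - 1))) at_top"
      using eventually_gt_at_top[of 0]
    proof eventually_elim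
      case (elim x)
      have "x powr (- s - 1) = x powr (- s) / x powr 1" by (rule powr_diff)
      also have "\<dots> = exp (- s * ln x) / x" using elim by (simp add: powr_def)
      finally show ?case by simp
    qed
  qed
  finally show ?thesis .
qed

lemma asymp_equiv_exp_to_powr:
  fixes h :: "real \<Rightarrow> complex"
  assumes "h \<sim>[at_top] k"
    and "\<And>x. x > 0 \<Longrightarrow> g x = of_real (1 / x) * h (ln x)"
    and "\<And>x. x > 0 \<Longrightarrow> m x = of_real (1 / x) * k (ln x)"
  shows "g \<sim>[at_top] m"
proof -
  have "(\<lambda>x. of_real (1 / x) * h (ln x)) \<sim>[at_top] (\<lambda>x. of_real (1 / x) * k (ln x))"
    by (intro asymp_equiv_intros asymp_equiv_compose'[OF assms(1) ln_at_top])
  also have "?this \<longleftrightarrow> ?thesis"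
    by (intro asymp_equiv_cong eventually_mono[OF eventually_gt_at_top[of 0]]) (simp_all add: assms(2,3))
  finally show ?thesis .
qed

section \<open>Densities of a positive variable and its logarithm\<close>

lemma continuous_density_integral_indicator:
  assumes "continuous_density M X S f" "{a..b} \<subseteq> S"
  shows "(\<integral>\<omega>. indicator {a..b} (X \<omega>) \<partial>M) = integral {a..b} f"
proof -
  have dist: "distributed M lborel X (\<lambda>x. ennreal (f x))" and nonneg: "\<And>x. 0 \<le> f x" and cont: "continuous_on S f"
    using assms(1) by (auto simp: continuous_density_def)
  have "(\<integral>\<omega>. indicator {a..b} (X \<omega>) \<partial>M) = (\<integral>x. f x * indicator {a..b} x \<partial>lborel)"
    by (rule distributed_integral[OF dist, symmetric]) (auto simp: nonneg)
  also have "\<dots> = integral {a..b} f"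
  proof -
    have "set_integrable lborel {a..b} f"
      by (intro borel_integrable_atLeastAtMost' continuous_on_subset[OF cont assms(2)])
    from set_borel_integral_eq_integral(2)[OF this] show ?thesis
      by (simp add: set_lebesgue_integral_def mult.commute)
  qed
  finally show ?thesis .
qed

text \<open>Densities are unique only almost everywhere. Both candidates are continuous and give
  each interval the same probability, which forces equality at every point.\<close>

lemma continuous_density_ln:
  assumes X: "X \<in> borel_measurable M" "AE \<omega> in M. X \<omega> > 0"
    and fX: "continuous_density M X {0<..} fX"
    and fY: "continuous_density M (\<lambda>\<omega>. ln (X \<omega>)) UNIV fY"
  shows "fY y = exp y * fX (exp y)"
proof (rule continuous_eqI_integral[where f = fY and g = "\<lambda>y. exp y * fX (exp y)" and x = y])
  note [measurable] = X(1)
  have cont: "continuous_on {0<..} fX" using fX by (simp add: continuous_density_def)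
  show "continuous_on UNIV fY" using fY by (simp add: continuous_density_def)
  show "continuous_on UNIV (\<lambda>y. exp y * fX (exp y))"
    by (intro continuous_intros continuous_on_compose2[OF cont]) auto
  show "integral {a..b} fY = integral {a..b} (\<lambda>y. exp y * fX (exp y))" if "a \<le> b" for a b :: real
  proof -
    have sub: "{exp a..exp b} \<subseteq> {0 :: real<..}"
      by (auto intro: less_le_trans[OF exp_gt_zero])
    have "integral {a..b} fY = (\<integral>\<omega>. indicator {a..b} (ln (X \<omega>)) \<partial>M)"
      by (rule continuous_density_integral_indicator[OF fY, symmetric]) simp
    also have "\<dots> = (\<integral>\<omega>. indicator {exp a..exp b} (X \<omega>) \<partial>M)"
    proof (rule integral_cong_AE)
      show "AE \<omega> in M. indicator {a..b} (ln (X \<omega>)) = (indicator {exp a..exp b} (X \<omega>) :: real)"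
        using X(2)
      proof eventually_elim
        case (elim \<omega>)
        then have "a \<le> ln (X \<omega>) \<longleftrightarrow> exp a \<le> X \<omega>" "ln (X \<omega>) \<le> b \<longleftrightarrow> X \<omega> \<le> exp b"
          by (metis exp_le_cancel_iff exp_ln)+
        then show ?case by (simp add: indicator_def)
      qed
    qed measurable
    also have "\<dots> = integral {exp a..exp b} fX"
      by (rule continuous_density_integral_indicator[OF fX sub])
    also have "\<dots> = integral {a..b} (\<lambda>y. exp y * fX (exp y))"
    proof -
      have "((\<lambda>y. exp y *\<^sub>R fX (exp y)) has_integral (integral {exp a..exp b} fX)) {a..b}"
        by (rule has_integral_substitution[where c = "exp a" and d = "exp b"])
           (use that in \<open>auto intro!: continuous_on_subset[OF cont] derivative_eq_intros less_le_trans[OF exp_gt_zero]\<close>)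
      then show ?thesis by (simp add: integral_unique)
    qed
    finally show ?thesis .
  qed
qed

text \<open>Almost surely X^s = exp (s log X), so moments of X are exponential moments of the
  density of log X; s = 0 yields its total mass.\<close>

lemma continuous_density_ln_exp_moment:
  assumes X: "X \<in> borel_measurable M" "AE \<omega> in M. X \<omega> > 0"
    and fY: "continuous_density M (\<lambda>\<omega>. ln (X \<omega>)) UNIV fY"
  shows "integrable lborel (\<lambda>y. fY y * exp (s * y)) \<longleftrightarrow> integrable M (\<lambda>\<omega>. X \<omega> powr s)"
    and "(\<integral>y. fY y * exp (s * y) \<partial>lborel) = (\<integral>\<omega>. X \<omega> powr s \<partial>M)"
proof -
  note [measurable] = X(1)
  have dist: "distributed M lborel (\<lambda>\<omega>. ln (X \<omega>)) (\<lambda>x. ennreal (fY x))" and nonneg: "\<And>x. 0 \<le> fY x"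
    using fY by (auto simp: continuous_density_def)
  have AE: "AE \<omega> in M. exp (s * ln (X \<omega>)) = X \<omega> powr s"
    using X(2) by eventually_elim (simp add: powr_def)
  have "integrable lborel (\<lambda>y. fY y * exp (s * y)) \<longleftrightarrow> integrable M (\<lambda>\<omega>. exp (s * ln (X \<omega>)))"
    by (rule distributed_integrable[OF dist]) (auto simp: nonneg)
  also have "\<dots> \<longleftrightarrow> integrable M (\<lambda>\<omega>. X \<omega> powr s)"
    by (rule integrable_cong_AE) (use AE in measurable)
  finally show "integrable lborel (\<lambda>y. fY y * exp (s * y)) \<longleftrightarrow> integrable M (\<lambda>\<omega>. X \<omega> powr s)" .
  have "(\<integral>y. fY y * exp (s * y) \<partial>lborel) = (\<integral>\<omega>. exp (s * ln (X \<omega>)) \<partial>M)"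
    by (rule distributed_integral[OF dist]) (auto simp: nonneg)
  also have "\<dots> = (\<integral>\<omega>. X \<omega> powr s \<partial>M)"
    by (rule integral_cong_AE) (use AE in measurable)
  finally show "(\<integral>y. fY y * exp (s * y) \<partial>lborel) = (\<integral>\<omega>. X \<omega> powr s \<partial>M)" .
qed

theorem theorem6p4:
  fixes M :: "'a measure" and X Y :: "'a \<Rightarrow> real"
    and C D :: real and J K :: nat and a b a' b' :: "nat \<Rightarrow> real"
    and F :: "complex \<Rightarrow> complex" and fX fY :: "real \<Rightarrow> real"
    and \<rho>\<^sub>p :: real and \<nu> :: nat
  defines "F \<equiv> gamma_type_fun C D J a b K a' b'"
    and "Y \<equiv> (\<lambda>\<omega>. ln (X \<omega>))"
    and "\<rho>\<^sub>p \<equiv> real_of_ereal (rho_plus F)"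
    and "\<nu> \<equiv> pole_order F (of_real \<rho>\<^sub>p)"
  assumes "prob_space M"
    and "X \<in> borel_measurable M"
    and "AE \<omega> in M. X \<omega> > 0"
    and "moments_of_gamma_type M X C D J a b K a' b'"
    and "rho_plus F < \<infinity>"
    and "gamma_index J a K a' > 0"
    and "continuous_density M X {0<..} fX"
    and "continuous_density M Y UNIV fY"
  shows
    "(\<exists>\<eta>>0. (\<lambda>x. of_real (fX x) - of_real (x powr (- \<rho>\<^sub>p - 1)) *
         (\<Sum>l<\<nu>. (-1) ^ (l + 1) * sing_coeff F (l + 1) (of_real \<rho>\<^sub>p) / fact l * of_real (ln x ^ l)))
       \<in> O[at_top](\<lambda>x. complex_of_real (x powr (- \<rho>\<^sub>p - 1 - \<eta>)))) \<and>
     (\<nu> \<ge> 1) \<and>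
     ((\<lambda>x. of_real (fX x)) \<sim>[at_top]
       (\<lambda>x. (-1) ^ \<nu> * sing_coeff F \<nu> (of_real \<rho>\<^sub>p) / fact (\<nu> - 1) *
         complex_of_real (x powr (- \<rho>\<^sub>p - 1) * ln x ^ (\<nu> - 1)))) \<and>
     (\<nu> = 1 \<longrightarrow> (\<lambda>x. of_real (fX x)) \<sim>[at_top]
       (\<lambda>x. - residue F (of_real \<rho>\<^sub>p) * complex_of_real (x powr (- \<rho>\<^sub>p - 1)))) \<and>
     (\<forall>\<sigma>>0. (\<lambda>x. of_real (fX x) -
         (\<Sum>\<rho> | 0 < \<rho> \<and> \<rho> \<le> \<sigma> \<and> is_pole F (of_real \<rho>).
            \<Sum>l<pole_order F (of_real \<rho>).
              (-1) ^ (l + 1) * sing_coeff F (l + 1) (of_real \<rho>) / fact l *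
              of_real (x powr (- \<rho> - 1) * ln x ^ l)))
       \<in> O[at_top](\<lambda>x. complex_of_real (x powr (- \<sigma> - 1)))) \<and>
     (\<forall>y. fY y = exp y * fX (exp y)) \<and>
     (\<exists>\<eta>>0. (\<lambda>y. of_real (fY y) - of_real (exp (- \<rho>\<^sub>p * y)) *
         (\<Sum>l<\<nu>. (-1) ^ (l + 1) * sing_coeff F (l + 1) (of_real \<rho>\<^sub>p) / fact l * of_real (y ^ l)))
       \<in> O[at_top](\<lambda>y. complex_of_real (exp (- (\<rho>\<^sub>p + \<eta>) * y)))) \<and>
     ((\<lambda>y. of_real (fY y)) \<sim>[at_top]
       (\<lambda>y. (-1) ^ \<nu> * sing_coeff F \<nu> (of_real \<rho>\<^sub>p) / fact (\<nu> - 1) *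
         complex_of_real (exp (- \<rho>\<^sub>p * y) * y ^ (\<nu> - 1)))) \<and>
     (\<nu> = 1 \<longrightarrow> (\<lambda>y. of_real (fY y)) \<sim>[at_top]
       (\<lambda>y. - residue F (of_real \<rho>\<^sub>p) * complex_of_real (exp (- \<rho>\<^sub>p * y)))) \<and>
     (\<forall>\<sigma>>0. (\<lambda>y. of_real (fY y) -
         (\<Sum>\<rho> | 0 < \<rho> \<and> \<rho> \<le> \<sigma> \<and> is_pole F (of_real \<rho>).
            \<Sum>l<pole_order F (of_real \<rho>).
              (-1) ^ (l + 1) * sing_coeff F (l + 1) (of_real \<rho>) / fact l *
              of_real (exp (- \<rho> * y) * y ^ l)))
       \<in> O[at_top](\<lambda>y. complex_of_real (exp (- \<sigma> * y))))"
proof -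
  have D: "D > 0" and nz: "\<And>j. j \<in> {1..J} \<Longrightarrow> a j \<noteq> 0" "\<And>k. k \<in> {1..K} \<Longrightarrow> a' k \<noteq> 0"
    and "\<exists>s1 s2. s1 < s2 \<and> (\<forall>s\<in>{s1<..<s2}. integrable M (\<lambda>\<omega>. X \<omega> powr s) \<and>
             complex_of_real (\<integral>\<omega>. X \<omega> powr s \<partial>M) = F (of_real s))"
    using assms(8) unfolding moments_of_gamma_type_def F_def by auto
  then obtain s1 s2 where s12: "s1 < s2"
    and mom: "\<And>s. s1 < s \<Longrightarrow> s < s2 \<Longrightarrow> integrable M (\<lambda>\<omega>. X \<omega> powr s)"
      "\<And>s. s1 < s \<Longrightarrow> s < s2 \<Longrightarrow> complex_of_real (\<integral>\<omega>. X \<omega> powr s \<partial>M) = F (of_real s)"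
    by auto
  interpret prob_space M by fact
  interpret gamma_type_data C D J K a b a' b'
    by unfold_locales (use D nz in auto)
  have dens: "continuous_density M (\<lambda>\<omega>. ln (X \<omega>)) UNIV fY"
    using assms(12) by (simp add: Y_def)
  note exp_moment = continuous_density_ln_exp_moment[OF assms(6,7) dens]
  have fY_nonneg: "0 \<le> fY y" and fY_cont: "continuous_on UNIV fY" for y
    using dens by (auto simp: continuous_density_def)
  have fY_int: "integrable lborel fY" and fY_total: "(\<integral>y. fY y \<partial>lborel) = 1"
  proof -
    \<comment> \<open>The value \<open>0 powr 0\<close> is 0, so this relies on X being positive
      almost surely.\<close>
    have one: "AE \<omega> in M. X \<omega> powr 0 = 1" using assms(7) by eventually_elim simp
    have "integrable M (\<lambda>\<omega>. X \<omega> powr 0) \<longleftrightarrow> integrable M (\<lambda>\<omega>. 1 :: real)"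
      using assms(6) one by (intro integrable_cong_AE) auto
    then show "integrable lborel fY" using exp_moment(1)[of 0] by simp
    have "(\<integral>\<omega>. X \<omega> powr 0 \<partial>M) = (\<integral>\<omega>. 1 \<partial>M)"
      using assms(6) one by (intro integral_cong_AE) auto
    then show "(\<integral>y. fY y \<partial>lborel) = 1" using exp_moment(2)[of 0] by (simp add: prob_space)
  qed
  have nice: "F nicely_meromorphic_on UNIV"
    unfolding F_def by (rule gamma_type_fun_nicely_meromorphic)
  then have mero_at: "F meromorphic_on {z}" for z
    by (auto simp: nicely_meromorphic_on_def intro: meromorphic_on_subset)
  interpret meromorphic_laplace_decay F s1 s2 fY "pi / 2 * gamma_index J a K a'"
  proof unfold_locales
    show "vertical_rate F (- (pi / 2 * gamma_index J a K a'))"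
      using gamma_type_fun_vertical_rate by (simp add: F_def)
    show "Im z = 0" if "is_pole F z" for z
      using that gamma_type_fun_poles_real by (simp add: F_def)
  qed (use nice fY_nonneg fY_cont fY_int fY_total s12 mom exp_moment assms(10) in auto)
  have fY_fX: "fY y = exp y * fX (exp y)" for y
    by (rule continuous_density_ln[OF assms(6,7,11) dens])
  have fX_fY: "complex_of_real (fX x) = of_real (1 / x) * of_real (fY (ln x))" if "x > 0" for x
    using that by (simp add: fY_fX)
  have powr_exp: "x powr (- r - 1) = 1 / x * exp (- r * ln x)" if "x > 0" for x r :: real
    using that by (simp add: powr_diff) (simp add: powr_def)

  obtain c where c: "\<And>\<sigma>. \<sigma> > 0 \<Longrightarrow> \<sigma> > c \<Longrightarrow> \<not> is_pole F (of_real \<sigma>) \<Longrightarrow>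
    \<exists>K. \<forall>y. norm (of_real (fY y) - (\<Sum>\<rho> | 0 < \<rho> \<and> \<rho> \<le> \<sigma> \<and> is_pole F (of_real \<rho>). pole_term F \<rho> y)) \<le> K * exp (- \<sigma> * y)"
    by (rule density_expansion) (rule that)
  have expansion: "(\<lambda>y. of_real (fY y) - (\<Sum>\<rho> | 0 < \<rho> \<and> \<rho> \<le> \<sigma> \<and> is_pole F (of_real \<rho>). pole_term F \<rho> y))
    \<in> O[at_top](\<lambda>y. complex_of_real (exp (- \<sigma> * y)))" if "\<sigma> > 0" for \<sigma>
    by (rule expansion_bigo[OF _ that]) (rule c)

  have ex_pole: "\<exists>x>0. is_pole F (complex_of_real x)"
    using assms(9) by (auto simp: rho_plus_def split: if_splits)
  then have \<rho>: "\<rho>\<^sub>p = (LEAST x::real. 0 < x \<and> is_pole F (of_real x))"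
    by (simp add: \<rho>\<^sub>p_def rho_plus_def)
  obtain \<eta> where \<eta>: "\<rho>\<^sub>p > 0" "is_pole F (of_real \<rho>\<^sub>p)" "\<eta> > 0"
    "{x. 0 < x \<and> x \<le> \<rho>\<^sub>p + \<eta> \<and> is_pole F (of_real x)} = {\<rho>\<^sub>p}"
    by (rule isolated_least_pole[OF ex_pole, folded \<rho>]) (rule that)
  \<comment> \<open>At \<sigma> = \<open>\<rho>\<^sub>p + \<eta>\<close> the only pole counted is
    \<open>\<rho>\<^sub>p\<close>, so the gap \<eta> becomes the gain in the error term.\<close>
  have leading: "(\<lambda>y. of_real (fY y) - pole_term F \<rho>\<^sub>p y) \<in> O[at_top](\<lambda>y. complex_of_real (exp (- (\<rho>\<^sub>p + \<eta>) * y)))"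
    using expansion[of "\<rho>\<^sub>p + \<eta>"] \<eta>(1,3) unfolding \<eta>(4) by simp
  have \<nu>: "\<nu> \<ge> 1" using sing_coeff_pole_order_neq_0[OF mero_at \<eta>(2)] by (simp add: \<nu>_def)
  have equiv: "(\<lambda>y. of_real (fY y)) \<sim>[at_top]
       (\<lambda>y. (-1) ^ \<nu> * sing_coeff F \<nu> (of_real \<rho>\<^sub>p) / fact (\<nu> - 1) *
         complex_of_real (exp (- \<rho>\<^sub>p * y) * y ^ (\<nu> - 1)))"
    unfolding \<nu>_def by (rule pole_term_asymp_equiv[OF mero_at \<eta>(2,3) leading])
  have Y1: "(\<lambda>y. of_real (fY y) - of_real (exp (- \<rho>\<^sub>p * y)) *
         (\<Sum>l<\<nu>. (-1) ^ (l + 1) * sing_coeff F (l + 1) (of_real \<rho>\<^sub>p) / fact l * of_real (y ^ l)))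
       \<in> O[at_top](\<lambda>y. complex_of_real (exp (- (\<rho>\<^sub>p + \<eta>) * y)))"
    using leading unfolding pole_term_factor \<nu>_def .
  have Y3: "(\<lambda>y. of_real (fY y)) \<sim>[at_top]
       (\<lambda>y. - residue F (of_real \<rho>\<^sub>p) * complex_of_real (exp (- \<rho>\<^sub>p * y)))" if "\<nu> = 1"
    using equiv unfolding that residue_eq_sing_coeff[OF mero_at] by simp
  have Y4: "(\<lambda>y. of_real (fY y) -
         (\<Sum>\<rho> | 0 < \<rho> \<and> \<rho> \<le> \<sigma> \<and> is_pole F (of_real \<rho>).
            \<Sum>l<pole_order F (of_real \<rho>).
              (-1) ^ (l + 1) * sing_coeff F (l + 1) (of_real \<rho>) / fact l *
              of_real (exp (- \<rho> * y) * y ^ l)))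
       \<in> O[at_top](\<lambda>y. complex_of_real (exp (- \<sigma> * y)))" if "\<sigma> > 0" for \<sigma>
    using expansion[OF that] unfolding pole_term_def .

  have X1: "(\<lambda>x. of_real (fX x) - of_real (x powr (- \<rho>\<^sub>p - 1)) *
         (\<Sum>l<\<nu>. (-1) ^ (l + 1) * sing_coeff F (l + 1) (of_real \<rho>\<^sub>p) / fact l * of_real (ln x ^ l)))
       \<in> O[at_top](\<lambda>x. complex_of_real (x powr (- \<rho>\<^sub>p - 1 - \<eta>)))"
  proof -
    have "(\<lambda>x. of_real (fX x) - of_real (x powr (- \<rho>\<^sub>p - 1)) *
         (\<Sum>l<\<nu>. (-1) ^ (l + 1) * sing_coeff F (l + 1) (of_real \<rho>\<^sub>p) / fact l * of_real (ln x ^ l)))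
       \<in> O[at_top](\<lambda>x. complex_of_real (x powr (- (\<rho>\<^sub>p + \<eta>) - 1)))"
    proof (rule bigo_exp_to_powr[OF Y1])
      fix x :: real assume x: "x > 0"
      show "of_real (fX x) - of_real (x powr (- \<rho>\<^sub>p - 1)) *
         (\<Sum>l<\<nu>. (-1) ^ (l + 1) * sing_coeff F (l + 1) (of_real \<rho>\<^sub>p) / fact l * of_real (ln x ^ l))
        = of_real (1 / x) * (of_real (fY (ln x)) - of_real (exp (- \<rho>\<^sub>p * ln x)) *
         (\<Sum>l<\<nu>. (-1) ^ (l + 1) * sing_coeff F (l + 1) (of_real \<rho>\<^sub>p) / fact l * of_real (ln x ^ l)))"
        unfolding fX_fY[OF x] powr_exp[OF x] of_real_mult by (simp only: right_diff_distrib mult.assoc)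
    qed
    also have "- (\<rho>\<^sub>p + \<eta>) - 1 = - \<rho>\<^sub>p - 1 - \<eta>" by simp
    finally show ?thesis .
  qed
  have X2: "(\<lambda>x. of_real (fX x)) \<sim>[at_top]
       (\<lambda>x. (-1) ^ \<nu> * sing_coeff F \<nu> (of_real \<rho>\<^sub>p) / fact (\<nu> - 1) *
         complex_of_real (x powr (- \<rho>\<^sub>p - 1) * ln x ^ (\<nu> - 1)))"
    by (rule asymp_equiv_exp_to_powr[OF equiv fX_fY]) (simp_all only: powr_exp of_real_mult mult_ac)
  have X3: "(\<lambda>x. of_real (fX x)) \<sim>[at_top]
       (\<lambda>x. - residue F (of_real \<rho>\<^sub>p) * complex_of_real (x powr (- \<rho>\<^sub>p - 1)))" if "\<nu> = 1"
    by (rule asymp_equiv_exp_to_powr[OF Y3[OF that] fX_fY]) (simp_all only: powr_exp of_real_mult mult_ac)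
  have X4: "(\<lambda>x. of_real (fX x) -
         (\<Sum>\<rho> | 0 < \<rho> \<and> \<rho> \<le> \<sigma> \<and> is_pole F (of_real \<rho>).
            \<Sum>l<pole_order F (of_real \<rho>).
              (-1) ^ (l + 1) * sing_coeff F (l + 1) (of_real \<rho>) / fact l *
              of_real (x powr (- \<rho> - 1) * ln x ^ l)))
       \<in> O[at_top](\<lambda>x. complex_of_real (x powr (- \<sigma> - 1)))" if "\<sigma> > 0" for \<sigma>
  proof (rule bigo_exp_to_powr[OF Y4[OF that]])
    fix x :: real assume x: "x > 0"
    show "of_real (fX x) -
         (\<Sum>\<rho> | 0 < \<rho> \<and> \<rho> \<le> \<sigma> \<and> is_pole F (of_real \<rho>).
            \<Sum>l<pole_order F (of_real \<rho>).
              (-1) ^ (l + 1) * sing_coeff F (l + 1) (of_real \<rho>) / fact l *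
              of_real (x powr (- \<rho> - 1) * ln x ^ l))
       = of_real (1 / x) * (of_real (fY (ln x)) -
         (\<Sum>\<rho> | 0 < \<rho> \<and> \<rho> \<le> \<sigma> \<and> is_pole F (of_real \<rho>).
            \<Sum>l<pole_order F (of_real \<rho>).
              (-1) ^ (l + 1) * sing_coeff F (l + 1) (of_real \<rho>) / fact l *
              of_real (exp (- \<rho> * ln x) * ln x ^ l)))"
      unfolding fX_fY[OF x] powr_exp[OF x] right_diff_distrib sum_distrib_left of_real_mult
      by (simp only: mult_ac)
  qed

  show ?thesis
    using \<eta>(3) X1 \<nu> X2 X3 X4 fY_fX Y1 equiv Y3 Y4 by blast
qed

end
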